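(* Let $S$ be a Polish space with Borel $\sigma$-algebra $\mathcal{B}(S)$, and let $R\subseteq S\times S$ be a reflexive, transitive relation which is an $F_\sigma$ subset of $S\times S$. Then for any Borel probability measures $\mu,\nu$ on $S$, \[ \max_{A\in R^{\ast}}\big(\mu(A)-\nu(A)\big)=\inf_{\pi\in\Pi(\mu,\nu)}\big(1-\pi(R)\big), \] where in particular the supremum on the left-hand side is attained by some $A\in R^\ast$. Moreover, the infimum on the right-hand side need not be attained: there exist a Polish space $S$, a reflexive transitive $F_\sigma$ relation $R$ on $S$, and Borel probability measures $\mu,\nu$ on $S$ for which no $\pi\in\Pi(\mu,\nu)$ achieves the infimum.
   Context: A coupling of Borel probability measures $\mu,\nu$ on $S$ is a Borel probability measure $\pi$ on $S\times S$ with $\pi(\,\cdot\,\times S)=\mu$ and $\pi(S\times\,\cdot\,)=\nu$; $\Pi(\mu,\nu)$ denotes the set of all couplings. The relation $R$ is reflexive if $(x,x)\in R$ for all $x$, transitive if $(x,y),(y,z)\in R$ imply $(x,z)\in R$, and $F_\sigma$ if it is a countable union of closed subsets of $S\times S$. The collection $R^\ast$ is defined by $R^{\ast}:=\{A\in\mathcal B(S):\text{ if }x\in A\text{ and }(x,y)\in R\text{ then }y\in A\}$. *)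

theory Defs
  imports "HOL-Analysis.Analysis" "HOL-Probability.Probability"
begin

definition borel_prob :: "'a::topological_space measure \<Rightarrow> bool" where
  "borel_prob \<mu> \<longleftrightarrow> prob_space \<mu> \<and> sets \<mu> = sets borel"

definition couplings ::
  "'a::topological_space measure \<Rightarrow> 'a measure \<Rightarrow> ('a \<times> 'a) measure set" where
  "couplings \<mu> \<nu> = {\<pi>. prob_space \<pi> \<and> sets \<pi> = sets borel \<and>
       distr \<pi> borel fst = \<mu> \<and> distr \<pi> borel snd = \<nu>}"

definition upsets :: "('a::topological_space \<times> 'a) set \<Rightarrow> 'a set set" where
  "upsets R = {A \<in> sets borel. \<forall>x y. x \<in> A \<and> (x, y) \<in> R \<longrightarrow> y \<in> A}"

end

theory Submission
  imports Defs
begin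

text \<open>
  For closed \<open>F\<close>, a coupling with \<open>1 - \<pi>(F) \<le> \<beta>\<close> exists as soon as \<open>\<mu>(A) - \<nu>(B) \<le> \<beta>\<close> for all Borel
  \<open>A\<close>, \<open>B\<close> with \<open>F[A] \<subseteq> B\<close>: on a finite partition this is max-flow min-cut, and the resulting couplings
  converge along a subsequence on a countable algebra of rectangles to a set function that is
  countably additive because its marginals are tight.

  Now let \<open>R\<close> be the increasing union of closed sets \<open>K\<^sub>n\<close>, and let \<open>(A\<^sub>n, B\<^sub>n)\<close> be near-optimal with
  \<open>K\<^sub>n[A\<^sub>n] \<subseteq> B\<^sub>n\<close>. Such pairs form a lattice on which \<open>\<mu>(A) - \<nu>(B)\<close> is modular, so with a fast enough
  subsequence the upper limits \<open>D = limsup A\<^sub>n\<close> and \<open>B = limsup B\<^sub>n\<close> are optimal and satisfy \<open>R[D] \<subseteq> B\<close>.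
  Replacing \<open>D\<close> by a \<open>\<sigma>\<close>-compact subset \<open>C\<close> of full measure, \<open>R[C]\<close> is an \<open>F\<^sub>\<sigma>\<close> upset attaining the maximum.

  The infimum is not attained for two copies of Lebesgue measure on the unit interval, where a point
  of the first copy lies below those points of the second copy with strictly larger coordinate: the
  value is \<open>0\<close>, but \<open>X < Y\<close> almost surely is impossible for bounded \<open>X\<close>, \<open>Y\<close> with the same law.
\<close>

section \<open>Flows on finite bipartite graphs\<close>

text \<open>Tychonoff's theorem for a product of intervals over an arbitrary index type. It gives
  compactness of the set of flows and, for a countable index set, replaces a diagonal
  argument.\<close>

lemma compact_fun_box:
  fixes c :: "'p \<Rightarrow> real"
  shows "compact {w. \<forall>p. 0 \<le> w p \<and> w p \<le> c p}"
proof -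
  have "compactin (product_topology (\<lambda>_. euclidean) UNIV) (PiE UNIV (\<lambda>p. {0..c p}))"
    by (subst compactin_PiE) auto
  then have "compact (PiE UNIV (\<lambda>p. {0..c p}))"
    unfolding euclidean_product_topology by simp
  moreover have "PiE UNIV (\<lambda>p. {0..c p}) = {w. \<forall>p. 0 \<le> w p \<and> w p \<le> c p}"
    by (auto simp: PiE_iff)
  ultimately show ?thesis by simp
qed

text \<open>Flows through the network source - \<open>I\<close> - \<open>J\<close> - sink: the outer
  edges have capacities \<open>a\<close> and \<open>b\<close>, the edges in \<open>E\<close> have no
  bound of their own. Functions are forced to be 0 off the edges so that no free coordinates spoil
  compactness.\<close>

definition flows :: "'i set \<Rightarrow> 'j set \<Rightarrow> ('i \<times> 'j) set \<Rightarrow> ('i \<Rightarrow> real) \<Rightarrow> ('j \<Rightarrow> real) \<Rightarrow> ('i \<times> 'j \<Rightarrow> real) set"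
  where "flows I J E a b = {w. (\<forall>p. 0 \<le> w p) \<and> (\<forall>p. p \<notin> E \<inter> I \<times> J \<longrightarrow> w p = 0) \<and>
    (\<forall>i\<in>I. (\<Sum>j\<in>J. w (i, j)) \<le> a i) \<and> (\<forall>j\<in>J. (\<Sum>i\<in>I. w (i, j)) \<le> b j)}"

lemma compact_flows:
  assumes "finite I" "finite J"
  shows "compact (flows I J E a b)"
proof -
  \<comment> \<open>An edge carries at most the capacity of its row; off the edges the box shrinks
    to 0.\<close>
  define c where "c = (\<lambda>p. if p \<in> E \<inter> I \<times> J then a (fst p) else 0)"
  define W where "W = {w. (\<forall>i\<in>I. (\<Sum>j\<in>J. w (i, j)) \<le> a i) \<and> (\<forall>j\<in>J. (\<Sum>i\<in>I. w (i, j)) \<le> b j)}"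
  have cont: "continuous_on UNIV (\<lambda>w::'a \<times> 'b \<Rightarrow> real. w p)" for p
    by simp
  have "closed W"
    unfolding W_def Ball_def
    by (intro closed_Collect_conj closed_Collect_all closed_Collect_imp open_Collect_const
        closed_Collect_le continuous_intros cont)
  moreover have "flows I J E a b = {w. \<forall>p. 0 \<le> w p \<and> w p \<le> c p} \<inter> W"
  proof (intro equalityI subsetI)
    fix w assume w: "w \<in> flows I J E a b"
    have "w (i, j) \<le> a i" if "i \<in> I" "j \<in> J" for i j
    proof -
      have "w (i, j) \<le> (\<Sum>j\<in>J. w (i, j))"
        using w that assms by (intro member_le_sum) (auto simp: flows_def)
      then show ?thesis using w that by (force simp: flows_def)
    qed
    then show "w \<in> {w. \<forall>p. 0 \<le> w p \<and> w p \<le> c p} \<inter> W"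
      using w by (auto simp: flows_def W_def c_def)
  next
    fix w assume w: "w \<in> {w. \<forall>p. 0 \<le> w p \<and> w p \<le> c p} \<inter> W"
    have "w p = 0" if "p \<notin> E \<inter> I \<times> J" for p
    proof -
      have "0 \<le> w p \<and> w p \<le> c p" using w by blast
      moreover have "c p = 0" using that by (auto simp: c_def)
      ultimately show ?thesis by linarith
    qed
    then show "w \<in> flows I J E a b"
      using w by (auto simp: flows_def W_def)
  qed
  ultimately show ?thesis
    by (simp only: compact_Int_closed[OF compact_fun_box])
qed

lemma sum_add_single:
  fixes f :: "'i \<Rightarrow> real"
  assumes "finite I"
  shows "(\<Sum>i\<in>I. f i + (if i = k then c else 0)) = sum f I + (if k \<in> I then c else 0)"
  using assms by (simp add: sum.distrib)

text \<open>A maximum exists by compactness, and \<open>X\<close> is the set of rows it leaves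
  unsaturated. The cut consists of the capacities of the other rows and of the columns adjacent to
  \<open>X\<close>.\<close>

lemma max_flow_min_cut:
  fixes a :: "'i \<Rightarrow> real" and b :: "'j \<Rightarrow> real"
  assumes fin: "finite I" "finite J" and nn: "\<And>i. i \<in> I \<Longrightarrow> 0 \<le> a i" "\<And>j. j \<in> J \<Longrightarrow> 0 \<le> b j"
  shows "\<exists>w\<in>flows I J E a b. \<exists>X\<subseteq>I. sum w (I \<times> J) = sum a (I - X) + sum b (J \<inter> E `` X)"
proof -
  have "(\<lambda>_. 0) \<in> flows I J E a b"
    using nn by (auto simp: flows_def)
  moreover have "continuous_on (flows I J E a b) (\<lambda>w. sum w (I \<times> J))"
    by (intro continuous_intros continuous_on_subset[OF continuous_on_product_coordinates]) auto
  ultimately obtain w0 where w0: "w0 \<in> flows I J E a b"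
    and w0_max: "\<And>w. w \<in> flows I J E a b \<Longrightarrow> sum w (I \<times> J) \<le> sum w0 (I \<times> J)"
    using continuous_attains_sup[OF compact_flows[OF fin]] by blast
  \<comment> \<open>Among the maximum flows pick one with the most unsaturated rows; these rows are the source
    side of a minimum cut, since a rerouting along a path of length two would unsaturate another row.\<close>
  define Opt where "Opt = {w \<in> flows I J E a b. sum w (I \<times> J) = sum w0 (I \<times> J)}"
  define U where "U w = {i \<in> I. (\<Sum>j\<in>J. w (i, j)) < a i}" for w
  have "\<exists>w. w \<in> Opt \<and> (\<forall>v. v \<in> Opt \<longrightarrow> card (U v) \<le> card (U w))"
  proof (rule ex_has_greatest_nat[where b = "Suc (card I)"])
    show "w0 \<in> Opt" using w0 by (simp add: Opt_def)
    show "\<forall>v. v \<in> Opt \<longrightarrow> card (U v) < Suc (card I)"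
      using fin by (auto simp: U_def less_Suc_eq_le intro!: card_mono)
  qed
  then obtain w where w: "w \<in> Opt" and wU: "\<And>v. v \<in> Opt \<Longrightarrow> card (U v) \<le> card (U w)"
    by blast
  have wf: "w \<in> flows I J E a b" and wmax: "\<And>v. v \<in> flows I J E a b \<Longrightarrow> sum v (I \<times> J) \<le> sum w (I \<times> J)"
    using w w0_max by (auto simp: Opt_def)
  have w_nn: "0 \<le> w p" for p using wf unfolding flows_def by blast
  have w_row: "i \<in> I \<Longrightarrow> (\<Sum>j\<in>J. w (i, j)) \<le> a i" for i using wf by (simp add: flows_def)
  have w_col: "j \<in> J \<Longrightarrow> (\<Sum>i\<in>I. w (i, j)) \<le> b j" for j using wf by (simp add: flows_def)
  have w_0: "p \<notin> E \<inter> I \<times> J \<Longrightarrow> w p = 0" for p using wf unfolding flows_def by blast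
  \<comment> \<open>An unsaturated row joined to an unsaturated column would admit the extra amount
    \<open>e\<close>, against maximality.\<close>
  have sat: "(\<Sum>i\<in>I. w (i, j)) = b j" if j: "j \<in> J" "i \<in> U w" "(i, j) \<in> E" for i j
  proof (rule ccontr)
    assume "(\<Sum>i\<in>I. w (i, j)) \<noteq> b j"
    then have lt: "(\<Sum>i\<in>I. w (i, j)) < b j" using w_col[OF j(1)] by simp
    have i: "i \<in> I" "(\<Sum>j\<in>J. w (i, j)) < a i" using j by (auto simp: U_def)
    define e where "e = min (b j - (\<Sum>i\<in>I. w (i, j))) (a i - (\<Sum>j\<in>J. w (i, j)))"
    have e: "0 < e" using lt i by (simp add: e_def)
    define v where "v = (\<lambda>p. w p + (if p = (i, j) then e else 0))"
    have row: "(\<Sum>j'\<in>J. v (i', j')) = (\<Sum>j'\<in>J. w (i', j')) + (if i' = i then e else 0)" for i'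
      using j fin by (cases "i' = i") (simp_all add: v_def sum_add_single)
    have col: "(\<Sum>i'\<in>I. v (i', j')) = (\<Sum>i'\<in>I. w (i', j')) + (if j' = j then e else 0)" for j'
      using i fin by (cases "j' = j") (simp_all add: v_def sum_add_single)
    have "v \<in> flows I J E a b"
      unfolding flows_def using w_row w_col w_nn w_0 e i j
      by (auto simp: row col) (auto simp: v_def e_def)
    moreover have "sum v (I \<times> J) = sum w (I \<times> J) + e"
      using i j fin by (simp add: v_def sum_add_single)
    ultimately show False using wmax[of v] e by simp
  qed
  have closed: "i' \<in> U w" if j: "j \<in> J" "i \<in> U w" "(i, j) \<in> E" and i': "i' \<in> I" "0 < w (i', j)" for i j i'
  proof (rule ccontr)
    assume nU: "i' \<notin> U w"
    have i: "i \<in> I" "(\<Sum>j\<in>J. w (i, j)) < a i" "i \<noteq> i'" using j nU by (auto simp: U_def)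
    \<comment> \<open>Half of the slack is used so that row \<open>i\<close> stays strictly
      unsaturated after receiving \<open>e\<close>, while row \<open>i'\<close> becomes unsaturated
      by losing it. The total is unchanged.\<close>
    define e where "e = min (w (i', j)) ((a i - (\<Sum>j\<in>J. w (i, j))) / 2)"
    have e: "0 < e" "e \<le> w (i', j)" "e \<le> (a i - (\<Sum>j\<in>J. w (i, j))) / 2"
      unfolding e_def using i i' by (simp, (intro min.cobounded1 min.cobounded2)+)
    define v where "v = (\<lambda>p. w p + (if p = (i, j) then e else 0) + (if p = (i', j) then - e else 0))"
    have row: "(\<Sum>j'\<in>J. v (k, j')) = (\<Sum>j'\<in>J. w (k, j')) + (if k = i then e else 0) + (if k = i' then - e else 0)" for k
      using j fin i by (cases "k = i"; cases "k = i'") (simp_all add: v_def sum_add_single)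
    have col: "(\<Sum>k\<in>I. v (k, j')) = (\<Sum>k\<in>I. w (k, j'))" for j'
      using i i' fin by (cases "j' = j") (simp_all add: v_def sum_add_single)
    have v_0: "v p = 0" if "p \<notin> E \<inter> I \<times> J" for p
      using w_0[OF that] w_0[of "(i', j)"] i i' j that by (auto simp: v_def)
    have v_nn: "0 \<le> v p" for p
      using w_nn[of p] e i by (auto simp: v_def)
    have v_row: "(\<Sum>j'\<in>J. v (k, j')) \<le> a k" if "k \<in> I" for k
      using w_row[OF that] e i by (auto simp: row)
    have "v \<in> flows I J E a b"
      unfolding flows_def using w_col v_0 v_nn v_row by (auto simp: col)
    moreover have "sum v (I \<times> J) = sum w (I \<times> J)"
      using i i' j fin by (simp add: v_def sum_add_single)
    ultimately have "v \<in> Opt" using w by (simp add: Opt_def)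
    moreover have "insert i' (U w) \<subseteq> U v"
      using w_row[of i'] e i i' by (auto simp: U_def row)
    then have "card (insert i' (U w)) \<le> card (U v)"
      using fin by (intro card_mono) (auto simp: U_def)
    moreover have "card (insert i' (U w)) = Suc (card (U w))"
      using fin nU by (subst card_insert_disjoint) (auto simp: U_def)
    ultimately show False using wU[of v] by simp
  qed
  define X where "X = U w"
  have X: "X \<subseteq> I" by (auto simp: X_def U_def)
  \<comment> \<open>Rows outside \<open>X\<close> are full. Rows in \<open>X\<close> send mass only
    to adjacent columns, which are full by \<open>sat\<close> and receive nothing from rows outside
    \<open>X\<close> by \<open>closed\<close>.\<close>
  have "sum w (I \<times> J) = (\<Sum>i\<in>I. \<Sum>j\<in>J. w (i, j))"
    by (simp add: sum.cartesian_product)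
  also have "\<dots> = (\<Sum>i\<in>I - X. \<Sum>j\<in>J. w (i, j)) + (\<Sum>i\<in>X. \<Sum>j\<in>J. w (i, j))"
    using X fin(1) by (rule sum.subset_diff)
  also have "(\<Sum>i\<in>I - X. \<Sum>j\<in>J. w (i, j)) = sum a (I - X)"
  proof (rule sum.cong)
    show "(\<Sum>j\<in>J. w (i, j)) = a i" if "i \<in> I - X" for i
      using that w_row[of i] by (auto simp: X_def U_def)
  qed simp
  also have "(\<Sum>i\<in>X. \<Sum>j\<in>J. w (i, j)) = (\<Sum>i\<in>X. \<Sum>j\<in>J \<inter> E `` X. w (i, j))"
    using fin by (intro sum.cong[OF refl] sum.mono_neutral_right) (auto intro!: w_0)
  also have "\<dots> = (\<Sum>j\<in>J \<inter> E `` X. \<Sum>i\<in>X. w (i, j))"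
    by (rule sum.swap)
  also have "\<dots> = (\<Sum>j\<in>J \<inter> E `` X. \<Sum>i\<in>I. w (i, j))"
  proof (rule sum.cong[OF refl])
    fix j assume "j \<in> J \<inter> E `` X"
    then have "w (i, j) = 0" if "i \<in> I - X" for i
      using that closed[of j _ i] w_nn[of "(i, j)"] by (force simp: X_def)
    then show "(\<Sum>i\<in>X. w (i, j)) = (\<Sum>i\<in>I. w (i, j))"
      using fin X by (intro sum.mono_neutral_left) auto
  qed
  also have "\<dots> = sum b (J \<inter> E `` X)"
    using sat by (intro sum.cong) (auto simp: X_def)
  finally show ?thesis using wf X by blast
qed

text \<open>The cut condition, applied to the minimum cut, says that a maximum flow along
  \<open>E\<close> carries mass at least 1 - \<beta>. Only the remaining mass can fall off
  \<open>E\<close>.\<close>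

lemma finite_coupling:
  fixes a b :: "'i \<Rightarrow> real"
  assumes fin: "finite I" and nn: "\<And>i. i \<in> I \<Longrightarrow> 0 \<le> a i" "\<And>i. i \<in> I \<Longrightarrow> 0 \<le> b i"
    and total: "sum a I = 1" "sum b I = 1"
    and cut: "\<And>X. X \<subseteq> I \<Longrightarrow> sum a X \<le> sum b (I \<inter> E `` X) + \<beta>"
  shows "\<exists>w. (\<forall>i\<in>I. \<forall>j\<in>I. 0 \<le> w (i, j)) \<and> (\<forall>i\<in>I. (\<Sum>j\<in>I. w (i, j)) = a i) \<and>
    (\<forall>j\<in>I. (\<Sum>i\<in>I. w (i, j)) = b j) \<and> sum w (I \<times> I - E) \<le> \<beta>"
proof -
  obtain w X where w: "w \<in> flows I I E a b" and X: "X \<subseteq> I"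
    and wX: "sum w (I \<times> I) = sum a (I - X) + sum b (I \<inter> E `` X)"
    using max_flow_min_cut[of I I a b E] fin nn by blast
  define r where "r i = a i - (\<Sum>j\<in>I. w (i, j))" for i
  define c where "c j = b j - (\<Sum>i\<in>I. w (i, j))" for j
  define T where "T = 1 - sum w (I \<times> I)"
  have r: "0 \<le> r i" if "i \<in> I" for i using w that by (simp add: flows_def r_def)
  have c: "0 \<le> c i" if "i \<in> I" for i using w that by (simp add: flows_def c_def)
  have sr: "sum r I = T"
    by (simp add: r_def sum_subtractf total T_def sum.cartesian_product)
  have sc: "sum c I = T"
  proof -
    have "(\<Sum>j\<in>I. \<Sum>i\<in>I. w (i, j)) = sum w (I \<times> I)"
      by (subst sum.swap) (simp add: sum.cartesian_product)
    then show ?thesis by (simp add: c_def sum_subtractf total T_def)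
  qed
  have T0: "0 \<le> T" using sr r by (metis sum_nonneg)
  have rc0: "r i = 0 \<and> c i = 0" if "T = 0" "i \<in> I" for i
    using sr sc r c that fin by (metis sum_nonneg_eq_0_iff)
  have "sum a I = sum a (I - X) + sum a X"
    using X fin by (rule sum.subset_diff)
  then have T: "T \<le> \<beta>"
    using cut[OF X] wX total by (simp add: T_def)
  \<comment> \<open>The unmatched mass is coupled independently; if \<open>T = 0\<close> then the fraction is \<open>0\<close>, as it should be.\<close>
  define v where "v p = w p + r (fst p) * c (snd p) / T" for p
  have rT: "(\<Sum>j\<in>I. r i * c j / T) = r i" if "i \<in> I" for i
  proof -
    have "(\<Sum>j\<in>I. r i * c j / T) = r i * sum c I / T"
      by (simp add: sum_distrib_left sum_divide_distrib)
    then show ?thesis using sc rc0 that by (cases "T = 0") auto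
  qed
  have cT: "(\<Sum>i\<in>I. r i * c j / T) = c j" if "j \<in> I" for j
  proof -
    have "(\<Sum>i\<in>I. r i * c j / T) = sum r I * c j / T"
      by (simp add: sum_distrib_right sum_divide_distrib)
    then show ?thesis using sr rc0 that by (cases "T = 0") auto
  qed
  show ?thesis
  proof (intro exI[of _ v] conjI ballI)
    show "0 \<le> v (i, j)" if "i \<in> I" "j \<in> I" for i j
      using that w r c T0 by (auto simp: v_def flows_def)
    show "(\<Sum>j\<in>I. v (i, j)) = a i" if "i \<in> I" for i
      using that rT by (simp add: v_def sum.distrib r_def)
    show "(\<Sum>i\<in>I. v (i, j)) = b j" if "j \<in> I" for j
      using that cT by (simp add: v_def sum.distrib c_def)
    have "sum v (I \<times> I - E) = (\<Sum>p\<in>I \<times> I - E. r (fst p) * c (snd p) / T)"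
      using w by (intro sum.cong) (auto simp: v_def flows_def)
    also have "\<dots> \<le> (\<Sum>p\<in>I \<times> I. r (fst p) * c (snd p) / T)"
      using fin r c T0 by (intro sum_mono2) auto
    also have "\<dots> = (\<Sum>i\<in>I. \<Sum>j\<in>I. r i * c j / T)"
      by (simp add: sum.cartesian_product case_prod_beta)
    also have "\<dots> = T" using rT sr by simp
    finally show "sum v (I \<times> I - E) \<le> \<beta>" using T by simp
  qed
qed

section \<open>Couplings from finite partitions\<close>

lemma borel_probD:
  assumes "borel_prob \<mu>"
  shows "prob_space \<mu>" "sets \<mu> = sets borel" "space \<mu> = UNIV"
  using assms sets_eq_imp_space_eq[of \<mu> borel] by (auto simp: borel_prob_def)

lemma couplingsD:
  assumes "\<pi> \<in> couplings \<mu> \<nu>"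
  shows "prob_space \<pi>" "sets \<pi> = sets borel" "space \<pi> = UNIV"
    "distr \<pi> borel fst = \<mu>" "distr \<pi> borel snd = \<nu>"
  using assms sets_eq_imp_space_eq[of \<pi> borel] by (auto simp: couplings_def)

lemma sets_borel_Times:
  fixes A :: "'a::second_countable_topology set" and B :: "'b::second_countable_topology set"
  assumes "A \<in> sets borel" "B \<in> sets borel"
  shows "A \<times> B \<in> sets borel"
  using pair_measureI[OF assms] by (simp only: borel_prod)

lemma measure_coupling:
  fixes \<pi> :: "('a::second_countable_topology \<times> 'a) measure"
  assumes \<pi>: "\<pi> \<in> couplings \<mu> \<nu>" and A: "A \<in> sets borel"
  shows "measure \<pi> (A \<times> UNIV) = measure \<mu> A" "measure \<pi> (UNIV \<times> A) = measure \<nu> A"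
proof -
  note c = couplingsD[OF \<pi>]
  have fst: "fst \<in> measurable \<pi> borel" and snd: "snd \<in> measurable \<pi> borel"
    using c(2) by (simp_all add: measurable_cong_sets[OF c(2) refl] flip: borel_prod)
  have "measure \<mu> A = measure \<pi> (fst -` A)"
    using measure_distr[OF fst A] c by simp
  moreover have "fst -` A = A \<times> (UNIV :: 'a set)" by auto
  ultimately show "measure \<pi> (A \<times> UNIV) = measure \<mu> A" by simp
  have "measure \<nu> A = measure \<pi> (snd -` A)"
    using measure_distr[OF snd A] c by simp
  moreover have "snd -` A = (UNIV :: 'a set) \<times> A" by auto
  ultimately show "measure \<pi> (UNIV \<times> A) = measure \<nu> A" by simp
qed

text \<open>Finite measures agreeing on an intersection-stable generator are equal, so the marginals
  need checking on \<open>G\<close> only. This is what makes limits tractable, since a limit of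
  couplings is controlled just on a small class of sets.\<close>

lemma couplingsI:
  fixes \<pi> :: "('a::second_countable_topology \<times> 'a) measure"
  assumes \<mu>: "borel_prob \<mu>" and \<nu>: "borel_prob \<nu>" and s: "sets \<pi> = sets borel"
    and m: "\<And>A. A \<in> G \<Longrightarrow> emeasure \<pi> (A \<times> UNIV) = emeasure \<mu> A"
           "\<And>A. A \<in> G \<Longrightarrow> emeasure \<pi> (UNIV \<times> A) = emeasure \<nu> A"
    and G: "Int_stable G" "UNIV \<in> G" "sigma_sets UNIV G = sets borel"
  shows "\<pi> \<in> couplings \<mu> \<nu>"
proof -
  interpret M: prob_space \<mu> by (rule borel_probD[OF \<mu>])
  have sp: "space \<pi> = UNIV" using sets_eq_imp_space_eq[OF s] by simp
  have fst: "fst \<in> measurable \<pi> borel" and snd: "snd \<in> measurable \<pi> borel"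
    by (simp_all add: measurable_cong_sets[OF s refl] flip: borel_prod)
  have GB: "G \<subseteq> sets borel" using G(3) by (metis sigma_sets.Basic subsetI)
  have pr: "emeasure \<pi> UNIV = 1"
    using m(1)[OF G(2)] M.emeasure_space_1 borel_probD(3)[OF \<mu>] by simp
  then have "prob_space \<pi>" by (intro prob_spaceI) (simp add: sp)
  moreover have "distr \<pi> borel fst = \<mu>"
  proof (rule measure_eqI_generator_eq[OF G(1), where \<Omega> = UNIV and A = "\<lambda>_. UNIV"])
    show "emeasure (distr \<pi> borel fst) X = emeasure \<mu> X" if "X \<in> G" for X
    proof -
      have "fst -` X = X \<times> (UNIV :: 'a set)" by auto
      then show ?thesis using that m(1) GB by (subst emeasure_distr[OF fst]) (auto simp: sp)
    qed
    show "emeasure (distr \<pi> borel fst) UNIV \<noteq> \<infinity>"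
      using fst pr sp by (subst emeasure_distr) auto
  qed (use G borel_probD[OF \<mu>] in auto)
  moreover have "distr \<pi> borel snd = \<nu>"
  proof (rule measure_eqI_generator_eq[OF G(1), where \<Omega> = UNIV and A = "\<lambda>_. UNIV"])
    show "emeasure (distr \<pi> borel snd) X = emeasure \<nu> X" if "X \<in> G" for X
    proof -
      have "snd -` X = (UNIV :: 'a set) \<times> X" by auto
      then show ?thesis using that m(2) GB by (subst emeasure_distr[OF snd]) (auto simp: sp)
    qed
    show "emeasure (distr \<pi> borel snd) UNIV \<noteq> \<infinity>"
      using snd pr sp by (subst emeasure_distr) auto
  qed (use G borel_probD[OF \<nu>] in auto)
  ultimately show ?thesis using s by (simp add: couplings_def)
qed

lemma Int_stable_borel: "Int_stable (sets borel)"
  by (auto simp: Int_stable_def)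

lemma sigma_sets_borel: "sigma_sets UNIV (sets borel) = sets borel"
  using sets.sigma_sets_eq[of borel] by simp

lemma (in finite_measure) measure_eq_sum_fibres:
  assumes "finite X" "A \<in> sets M" "\<And>i. c -` {i} \<in> sets M"
  shows "(\<Sum>i\<in>X. measure M (A \<inter> c -` {i})) = measure M (A \<inter> c -` X)"
proof -
  have "measure M (\<Union>i\<in>X. A \<inter> c -` {i}) = (\<Sum>i\<in>X. measure M (A \<inter> c -` {i}))"
    using assms by (intro finite_measure_finite_Union) (auto simp: disjoint_family_on_def)
  moreover have "(\<Union>i\<in>X. A \<inter> c -` {i}) = A \<inter> c -` X" by auto
  ultimately show ?thesis by simp
qed

text \<open>Inside each product of two cells the coupling is a multiple of the product measure: the
  density with respect to it is constant there, chosen to give mass \<open>w (i, j)\<close>. The row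
  and column sums then produce the marginals.\<close>

lemma coupling_of_cell_weights:
  fixes \<mu> \<nu> :: "'a::second_countable_topology measure" and c :: "'a \<Rightarrow> 'c"
  assumes \<mu>: "borel_prob \<mu>" and \<nu>: "borel_prob \<nu>"
    and c: "\<And>i. c -` {i} \<in> sets borel" and fin: "finite (range c)"
    and w: "\<And>i j. i \<in> range c \<Longrightarrow> j \<in> range c \<Longrightarrow> 0 \<le> w (i, j)"
    and row: "\<And>i. i \<in> range c \<Longrightarrow> (\<Sum>j\<in>range c. w (i, j)) = measure \<mu> (c -` {i})"
    and col: "\<And>j. j \<in> range c \<Longrightarrow> (\<Sum>i\<in>range c. w (i, j)) = measure \<nu> (c -` {j})"
  shows "\<exists>\<pi>\<in>couplings \<mu> \<nu>. \<forall>i\<in>range c. \<forall>j\<in>range c. measure \<pi> (c -` {i} \<times> c -` {j}) = w (i, j)"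
proof -
  interpret M: prob_space \<mu> by (rule borel_probD[OF \<mu>])
  interpret N: prob_space \<nu> by (rule borel_probD[OF \<nu>])
  note [simp] = borel_probD(2,3)[OF \<mu>] borel_probD(2,3)[OF \<nu>]
  define I where "I = range c"
  define P where "P i = c -` {i}" for i
  have P[measurable]: "P i \<in> sets borel" for i using c by (simp add: P_def)
  define m where "m i = measure \<mu> (P i)" for i
  define n where "n i = measure \<nu> (P i)" for i
  have finI: "finite I" using fin by (simp add: I_def)
  have w_nn: "0 \<le> w (i, j)" if "i \<in> I" "j \<in> I" for i j using w that by (simp add: I_def)
  have rowI: "(\<Sum>j\<in>I. w (i, j)) = m i" if "i \<in> I" for i using row that by (simp add: I_def P_def m_def)
  have colI: "(\<Sum>i\<in>I. w (i, j)) = n j" if "j \<in> I" for j using col that by (simp add: I_def P_def n_def)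
  have m0: "w (i, j) = 0" if "m i = 0" "i \<in> I" "j \<in> I" for i j
    using rowI[OF that(2)] that sum_nonneg_eq_0_iff[OF finI, of "\<lambda>j. w (i, j)"] w_nn[OF that(2)] by simp
  have n0: "w (i, j) = 0" if "n j = 0" "i \<in> I" "j \<in> I" for i j
    using colI[OF that(3)] that sum_nonneg_eq_0_iff[OF finI, of "\<lambda>i. w (i, j)"] w_nn[OF _ that(3)] by simp
  have cI: "c -` I = UNIV" by (auto simp: I_def)
  have split: "(\<Sum>i\<in>I. measure \<mu> (A \<inter> P i)) = measure \<mu> A" "(\<Sum>i\<in>I. measure \<nu> (A \<inter> P i)) = measure \<nu> A"
    if "A \<in> sets borel" for A
    using M.measure_eq_sum_fibres[OF finI, of A c] N.measure_eq_sum_fibres[OF finI, of A c] that c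
    by (simp_all add: cI P_def)
  \<comment> \<open>On null cells the quotient is 0 by the convention for division by zero; this is
    the right value because \<open>m0\<close> and \<open>n0\<close> make the weight 0 there as
    well.\<close>
  define r where "r i j = w (i, j) / (m i * n j)" for i j
  have r_nn: "0 \<le> r i j" if "i \<in> I" "j \<in> I" for i j
    using w_nn[OF that] by (simp add: r_def m_def n_def)
  define h where "h p = (\<Sum>i\<in>I. \<Sum>j\<in>I. ennreal (r i j) * indicator (P i \<times> P j) p)" for p
  define \<pi> where "\<pi> = density (\<mu> \<Otimes>\<^sub>M \<nu>) h"
  have sB: "sets (\<mu> \<Otimes>\<^sub>M \<nu>) = sets borel"
    using sets_pair_measure_cong[OF borel_probD(2)[OF \<mu>] borel_probD(2)[OF \<nu>]] by (simp only: borel_prod)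
  have PP: "P i \<times> P j \<in> sets (\<mu> \<Otimes>\<^sub>M \<nu>)" for i j
    by (simp add: sB sets_borel_Times P)
  have h[measurable]: "h \<in> borel_measurable (\<mu> \<Otimes>\<^sub>M \<nu>)"
    unfolding h_def using PP by measurable
  have sets_\<pi>: "sets \<pi> = sets borel" unfolding \<pi>_def sets_density by (rule sB)
  have key: "emeasure \<pi> (A \<times> B) = ennreal (\<Sum>i\<in>I. \<Sum>j\<in>I. r i j * (measure \<mu> (A \<inter> P i) * measure \<nu> (B \<inter> P j)))"
    if A: "A \<in> sets borel" and B: "B \<in> sets borel" for A B
  proof -
    have AB: "A \<times> B \<in> sets (\<mu> \<Otimes>\<^sub>M \<nu>)" using A B by (simp add: sB sets_borel_Times)
    have "emeasure \<pi> (A \<times> B) = (\<integral>\<^sup>+ p. h p * indicator (A \<times> B) p \<partial>(\<mu> \<Otimes>\<^sub>M \<nu>))"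
      unfolding \<pi>_def by (rule emeasure_density[OF h AB])
    also have "\<dots> = (\<integral>\<^sup>+ p. (\<Sum>i\<in>I. \<Sum>j\<in>I. ennreal (r i j) * indicator ((A \<inter> P i) \<times> (B \<inter> P j)) p) \<partial>(\<mu> \<Otimes>\<^sub>M \<nu>))"
      unfolding h_def sum_distrib_right
      by (intro nn_integral_cong sum.cong refl) (auto simp: indicator_def)
    also have "\<dots> = (\<Sum>i\<in>I. \<Sum>j\<in>I. ennreal (r i j) * emeasure (\<mu> \<Otimes>\<^sub>M \<nu>) ((A \<inter> P i) \<times> (B \<inter> P j)))"
    proof -
      have *: "(A \<inter> P i) \<times> (B \<inter> P j) \<in> sets (\<mu> \<Otimes>\<^sub>M \<nu>)" for i j
        using A B P by (simp add: sB sets_borel_Times)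
      have **: "(\<lambda>p. ennreal (r i j) * indicator ((A \<inter> P i) \<times> (B \<inter> P j)) p) \<in> borel_measurable (\<mu> \<Otimes>\<^sub>M \<nu>)" for i j
        by (intro borel_measurable_times_ennreal borel_measurable_indicator borel_measurable_const *)
      show ?thesis
        by (subst nn_integral_sum, intro borel_measurable_sum **, intro sum.cong refl,
            subst nn_integral_sum, intro **, intro sum.cong refl nn_integral_cmult_indicator *)
    qed
    also have "\<dots> = (\<Sum>i\<in>I. \<Sum>j\<in>I. ennreal (r i j * (measure \<mu> (A \<inter> P i) * measure \<nu> (B \<inter> P j))))"
    proof (intro sum.cong refl)
      fix i j assume ij: "i \<in> I" "j \<in> I"
      have "emeasure (\<mu> \<Otimes>\<^sub>M \<nu>) ((A \<inter> P i) \<times> (B \<inter> P j)) = emeasure \<mu> (A \<inter> P i) * emeasure \<nu> (B \<inter> P j)"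
        using A B P by (intro N.emeasure_pair_measure_Times) auto
      then show "ennreal (r i j) * emeasure (\<mu> \<Otimes>\<^sub>M \<nu>) ((A \<inter> P i) \<times> (B \<inter> P j)) =
          ennreal (r i j * (measure \<mu> (A \<inter> P i) * measure \<nu> (B \<inter> P j)))"
        using r_nn[OF ij] by (simp add: M.emeasure_eq_measure N.emeasure_eq_measure ennreal_mult)
    qed
    also have "\<dots> = ennreal (\<Sum>i\<in>I. \<Sum>j\<in>I. r i j * (measure \<mu> (A \<inter> P i) * measure \<nu> (B \<inter> P j)))"
      using r_nn by (simp add: sum_ennreal sum_nonneg)
    finally show ?thesis .
  qed
  have rn: "r i j * (x * n j) = x * w (i, j) / m i" if "i \<in> I" "j \<in> I" for i j x
    using n0 m0 that by (cases "n j = 0") (auto simp: r_def)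
  have rm: "r i j * (m i * x) = x * w (i, j) / n j" if "i \<in> I" "j \<in> I" for i j x
    using n0 m0 that by (cases "m i = 0") (auto simp: r_def)
  have mle: "m i = 0 \<Longrightarrow> measure \<mu> (A \<inter> P i) = 0" if "A \<in> sets borel" for A i
    using M.finite_measure_mono[of "A \<inter> P i" "P i"] by (simp add: m_def measure_le_0_iff)
  have nle: "n i = 0 \<Longrightarrow> measure \<nu> (A \<inter> P i) = 0" if "A \<in> sets borel" for A i
    using N.finite_measure_mono[of "A \<inter> P i" "P i"] by (simp add: n_def measure_le_0_iff)
  have "\<pi> \<in> couplings \<mu> \<nu>"
  proof (rule couplingsI[OF \<mu> \<nu> sets_\<pi> _ _ Int_stable_borel _ sigma_sets_borel])
    fix A :: "'a set" assume A: "A \<in> sets borel"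
    have "(\<Sum>i\<in>I. \<Sum>j\<in>I. r i j * (measure \<mu> (A \<inter> P i) * measure \<nu> (UNIV \<inter> P j)))
        = (\<Sum>i\<in>I. \<Sum>j\<in>I. measure \<mu> (A \<inter> P i) * w (i, j) / m i)"
      by (intro sum.cong refl) (simp add: rn flip: n_def)
    also have "\<dots> = (\<Sum>i\<in>I. measure \<mu> (A \<inter> P i) * m i / m i)"
      by (intro sum.cong refl) (simp add: rowI flip: sum_distrib_left sum_divide_distrib)
    also have "\<dots> = (\<Sum>i\<in>I. measure \<mu> (A \<inter> P i))"
      using mle[OF A] by (intro sum.cong refl) auto
    also have "\<dots> = measure \<mu> A"
      using A by (rule split)
    finally show "emeasure \<pi> (A \<times> UNIV) = emeasure \<mu> A"
      using A by (simp add: key M.emeasure_eq_measure)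
    have "(\<Sum>i\<in>I. \<Sum>j\<in>I. r i j * (measure \<mu> (UNIV \<inter> P i) * measure \<nu> (A \<inter> P j)))
        = (\<Sum>i\<in>I. \<Sum>j\<in>I. measure \<nu> (A \<inter> P j) * w (i, j) / n j)"
      by (intro sum.cong refl) (simp add: rm flip: m_def)
    also have "\<dots> = (\<Sum>j\<in>I. \<Sum>i\<in>I. measure \<nu> (A \<inter> P j) * w (i, j) / n j)"
      by (rule sum.swap)
    also have "\<dots> = (\<Sum>j\<in>I. measure \<nu> (A \<inter> P j) * n j / n j)"
      by (intro sum.cong refl) (simp add: colI flip: sum_distrib_left sum_divide_distrib)
    also have "\<dots> = (\<Sum>j\<in>I. measure \<nu> (A \<inter> P j))"
      using nle[OF A] by (intro sum.cong refl) auto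
    also have "\<dots> = measure \<nu> A"
      using A by (rule split)
    finally show "emeasure \<pi> (UNIV \<times> A) = emeasure \<nu> A"
      using A by (simp add: key N.emeasure_eq_measure)
  qed simp
  moreover have "measure \<pi> (P i \<times> P j) = w (i, j)" if ij: "i \<in> I" "j \<in> I" for i j
  proof -
    have PI: "P i \<inter> P k = (if k = i then P i else {})" for i k by (auto simp: P_def)
    have "(\<Sum>k\<in>I. \<Sum>l\<in>I. r k l * (measure \<mu> (P i \<inter> P k) * measure \<nu> (P j \<inter> P l)))
        = (\<Sum>k\<in>I. \<Sum>l\<in>I. if l = j then (if k = i then r i j * (m i * n j) else 0) else 0)"
      by (intro sum.cong refl) (auto simp: PI m_def n_def)
    also have "\<dots> = r i j * (m i * n j)"
      using ij finI by simp
    also have "\<dots> = w (i, j)"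
      using rn[OF ij, of "m i"] m0 ij by auto
    finally have "emeasure \<pi> (P i \<times> P j) = ennreal (w (i, j))"
      by (simp add: key)
    then show ?thesis using w_nn[OF ij] by (simp add: measure_def)
  qed
  ultimately show ?thesis unfolding I_def P_def by blast
qed

text \<open>Two cells are related by \<open>E\<close> when \<open>F\<close> contains a pair of
  points from them. The image under \<open>F\<close> of a union of cells is then covered by the
  \<open>E\<close>-related cells, which turns the hypothesis into the finite cut condition. The
  Borel superset \<open>B\<close> stands in for the image of \<open>A\<close>, which need not be
  Borel itself.\<close>

lemma finite_partition_coupling:
  fixes \<mu> \<nu> :: "'a::second_countable_topology measure" and c :: "'a \<Rightarrow> 'c"
  assumes \<mu>: "borel_prob \<mu>" and \<nu>: "borel_prob \<nu>"
    and c: "\<And>i. c -` {i} \<in> sets borel" and fin: "finite (range c)"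
    and F: "\<And>A B. A \<in> sets borel \<Longrightarrow> B \<in> sets borel \<Longrightarrow> F `` A \<subseteq> B \<Longrightarrow> measure \<mu> A \<le> measure \<nu> B + \<beta>"
  shows "\<exists>\<pi>\<in>couplings \<mu> \<nu>. measure \<pi> {(x, y). (c x, c y) \<notin> map_prod c c ` F} \<le> \<beta>"
proof -
  define E where "E = map_prod c c ` F"
  define I where "I = range c"
  have cX: "c -` X \<in> sets borel" if "X \<subseteq> I" for X
  proof -
    have "c -` X = (\<Union>i\<in>X. c -` {i})" by auto
    moreover have "finite X" using that fin by (auto simp: I_def intro: finite_subset)
    ultimately show ?thesis using c by (simp add: sets.finite_UN)
  qed
  have cXM: "(\<Sum>i\<in>X. measure M (c -` {i})) = measure M (c -` X)"
    if "X \<subseteq> I" "borel_prob M" for X and M :: "'a measure"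
    using finite_measure.measure_eq_sum_fibres[of M X UNIV c] that fin c borel_probD[OF that(2)]
    by (auto simp: I_def prob_space.finite_measure intro: finite_subset)
  have UI: "c -` I = UNIV" by (auto simp: I_def)
  obtain w where w: "\<forall>i\<in>I. \<forall>j\<in>I. 0 \<le> w (i, j)"
    "\<forall>i\<in>I. (\<Sum>j\<in>I. w (i, j)) = measure \<mu> (c -` {i})"
    "\<forall>j\<in>I. (\<Sum>i\<in>I. w (i, j)) = measure \<nu> (c -` {j})"
    "sum w (I \<times> I - E) \<le> \<beta>"
  proof (rule exE[OF finite_coupling, of I "\<lambda>i. measure \<mu> (c -` {i})" "\<lambda>i. measure \<nu> (c -` {i})" E \<beta>])
    show "finite I" using fin by (simp add: I_def)
    show "(\<Sum>i\<in>I. measure \<mu> (c -` {i})) = 1"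
      using cXM[OF _ \<mu>, of I] borel_probD[OF \<mu>] prob_space.prob_space[of \<mu>] by (simp add: UI)
    show "(\<Sum>i\<in>I. measure \<nu> (c -` {i})) = 1"
      using cXM[OF _ \<nu>, of I] borel_probD[OF \<nu>] prob_space.prob_space[of \<nu>] by (simp add: UI)
    show "(\<Sum>i\<in>X. measure \<mu> (c -` {i})) \<le> (\<Sum>i\<in>I \<inter> E `` X. measure \<nu> (c -` {i})) + \<beta>" if X: "X \<subseteq> I" for X
    proof -
      have "F `` (c -` X) \<subseteq> c -` (I \<inter> E `` X)"
        by (force simp: E_def I_def)
      then have "measure \<mu> (c -` X) \<le> measure \<nu> (c -` (I \<inter> E `` X)) + \<beta>"
        using X by (intro F cX) auto
      then show ?thesis
        using X cXM[OF X \<mu>] cXM[OF _ \<nu>, of "I \<inter> E `` X"] by simp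
    qed
  qed auto
  obtain \<pi> where \<pi>: "\<pi> \<in> couplings \<mu> \<nu>"
    and \<pi>w: "\<And>i j. i \<in> I \<Longrightarrow> j \<in> I \<Longrightarrow> measure \<pi> (c -` {i} \<times> c -` {j}) = w (i, j)"
    using coupling_of_cell_weights[OF \<mu> \<nu> c fin, of w] w unfolding I_def by blast
  interpret prob_space \<pi> by (rule couplingsD[OF \<pi>])
  have "{(x, y). (c x, c y) \<notin> E} = (\<Union>p\<in>I \<times> I - E. c -` {fst p} \<times> c -` {snd p})"
    by (auto simp: I_def Bex_def) blast
  moreover have "measure \<pi> (\<Union>p\<in>I \<times> I - E. c -` {fst p} \<times> c -` {snd p})
      = (\<Sum>p\<in>I \<times> I - E. measure \<pi> (c -` {fst p} \<times> c -` {snd p}))"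
    using fin c couplingsD(2)[OF \<pi>]
    by (intro finite_measure_finite_Union) (auto simp: disjoint_family_on_def I_def sets_borel_Times)
  moreover have "\<dots> = sum w (I \<times> I - E)"
    using \<pi>w by (intro sum.cong) auto
  ultimately show ?thesis using \<pi> w(4) unfolding E_def by force
qed

section \<open>Limits of couplings\<close>

lemma inner_regular_diff:
  fixes \<mu> :: "'a::polish_space measure"
  assumes \<mu>: "borel_prob \<mu>" and A: "A \<in> sets borel" and e: "0 < e"
  shows "\<exists>K. compact K \<and> K \<subseteq> A \<and> measure \<mu> (A - K) < e"
proof -
  interpret M: prob_space \<mu> by (rule borel_probD[OF \<mu>])
  note s = borel_probD(2)[OF \<mu>]
  show ?thesis
  proof (cases "measure \<mu> A < e")
    case True
    then show ?thesis by (intro exI[of _ "{}"]) auto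
  next
    case False
    have "ennreal (measure \<mu> A - e) < ennreal (measure \<mu> A)"
      using e False by (intro ennreal_lessI) auto
    also have "\<dots> = (SUP K\<in>{K. K \<subseteq> A \<and> compact K}. emeasure \<mu> K)"
      using inner_regular[OF s _ A] by (simp add: M.emeasure_eq_measure)
    finally obtain K where K: "K \<subseteq> A" "compact K" "ennreal (measure \<mu> A - e) < emeasure \<mu> K"
      by (auto simp: less_SUP_iff)
    then have "measure \<mu> A - e < measure \<mu> K"
      using False e by (simp add: M.emeasure_eq_measure ennreal_less_iff)
    moreover have "measure \<mu> (A - K) = measure \<mu> A - measure \<mu> K"
      using K A s by (intro M.finite_measure_Diff) (auto intro: borel_compact)
    ultimately show ?thesis using K by (intro exI[of _ K]) auto
  qed
qed

text \<open>Each side of each rectangle is shrunk to a compact set, halving \<open>e\<close> at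
  every induction step. The part lost lies in strips \<open>N \<times> UNIV\<close> and
  \<open>UNIV \<times> N'\<close>, whose masses are the same for all couplings.\<close>

lemma rectangles_inner_compact:
  fixes \<mu> \<nu> :: "'a::polish_space measure"
  assumes \<mu>: "borel_prob \<mu>" and \<nu>: "borel_prob \<nu>"
    and "finite D" "D \<subseteq> sets borel \<times> sets borel" "0 < e"
  shows "\<exists>C N N'. compact C \<and> C \<subseteq> (\<Union>(U, V)\<in>D. U \<times> V) \<and> N \<in> sets borel \<and> N' \<in> sets borel \<and>
    (\<Union>(U, V)\<in>D. U \<times> V) \<subseteq> C \<union> N \<times> UNIV \<union> UNIV \<times> N' \<and> measure \<mu> N < e \<and> measure \<nu> N' < e"
  using assms(3-)
proof (induction arbitrary: e rule: finite_induct)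
  case empty
  then show ?case by (intro exI[of _ "{}"]) auto
next
  case (insert p D)
  interpret M: prob_space \<mu> by (rule borel_probD[OF \<mu>])
  interpret N: prob_space \<nu> by (rule borel_probD[OF \<nu>])
  note [simp] = borel_probD(2)[OF \<mu>] borel_probD(2)[OF \<nu>]
  obtain U V where p: "p = (U, V)" "U \<in> sets borel" "V \<in> sets borel"
    using insert by auto
  obtain C N N' where C: "compact C" "C \<subseteq> (\<Union>(U, V)\<in>D. U \<times> V)" "N \<in> sets borel" "N' \<in> sets borel"
    "(\<Union>(U, V)\<in>D. U \<times> V) \<subseteq> C \<union> N \<times> UNIV \<union> UNIV \<times> N'" "measure \<mu> N < e / 2" "measure \<nu> N' < e / 2"
    using insert.IH[of "e / 2"] insert.prems by auto
  obtain K where K: "compact K" "K \<subseteq> U" "measure \<mu> (U - K) < e / 2"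
    using inner_regular_diff[OF \<mu> p(2), of "e / 2"] insert by auto
  obtain K' where K': "compact K'" "K' \<subseteq> V" "measure \<nu> (V - K') < e / 2"
    using inner_regular_diff[OF \<nu> p(3), of "e / 2"] insert by auto
  have N: "U - K \<in> sets borel" "V - K' \<in> sets borel"
    using p K K' by (auto intro: borel_compact)
  show ?case
  proof (intro exI conjI)
    show "compact (C \<union> K \<times> K')"
      using C K K' by (intro compact_Un compact_Times)
    show "C \<union> K \<times> K' \<subseteq> (\<Union>(U, V)\<in>insert p D. U \<times> V)"
      using C K K' p by auto
    show "N \<union> (U - K) \<in> sets borel" "N' \<union> (V - K') \<in> sets borel" using C N by auto
    show "(\<Union>(U, V)\<in>insert p D. U \<times> V) \<subseteq> C \<union> K \<times> K' \<union> (N \<union> (U - K)) \<times> UNIV \<union> UNIV \<times> (N' \<union> (V - K'))"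
      using C(5) p(1) by auto
    show "measure \<mu> (N \<union> (U - K)) < e"
      using measure_Un_le[of N \<mu> "U - K"] C K N by auto
    show "measure \<nu> (N' \<union> (V - K')) < e"
      using measure_Un_le[of N' \<nu> "V - K'"] C K' N by auto
  qed
qed

text \<open>After enumerating \<open>G\<close> the functions become points of a countable power of
  the unit interval, which is sequentially compact.\<close>

lemma ex_convergent_subseq_on_countable:
  fixes f :: "nat \<Rightarrow> 'a \<Rightarrow> real"
  assumes "countable G" and "\<And>k x. 0 \<le> f k x" "\<And>k x. f k x \<le> 1"
  shows "\<exists>s. strict_mono s \<and> (\<forall>x\<in>G. convergent (\<lambda>k. f (s k) x))"
proof (cases "G = {}")
  case True
  then show ?thesis using strict_mono_id by blast
next
  case False
  define g where "g = from_nat_into G"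
  have "seq_compact {w. \<forall>p::nat. 0 \<le> w p \<and> w p \<le> (1::real)}"
    by (intro compact_imp_seq_compact compact_fun_box)
  moreover have "\<forall>k. (\<lambda>i. f k (g i)) \<in> {w. \<forall>p. 0 \<le> w p \<and> w p \<le> 1}"
    using assms by auto
  ultimately obtain l s where s: "strict_mono s" "((\<lambda>k i. f k (g i)) \<circ> s) \<longlonglongrightarrow> l"
    by (rule seq_compactE)
  have "convergent (\<lambda>k. f (s k) x)" if x: "x \<in> G" for x
  proof -
    obtain i where i: "x = g i"
      using from_nat_into_surj[OF assms(1) x] by (auto simp: g_def)
    have "(\<lambda>k. ((\<lambda>k i. f k (g i)) \<circ> s) k i) \<longlonglongrightarrow> l i"
      using continuous_on_tendsto_compose[OF continuous_on_product_coordinates[of i] s(2)] by simp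
    then show ?thesis by (auto simp: i convergent_def o_def)
  qed
  then show ?thesis using s by blast
qed

text \<open>A form of Prohorov's theorem with setwise convergence on a countable algebra. The limit
  is finitely additive there; continuity at the empty set makes it extend by Caratheodory's theorem.
  \<open>H\<close> is a generator consisting of sets whose cylinders belong to the algebra, so the
  marginals survive the limit.\<close>

lemma couplings_limit:
  fixes \<mu> \<nu> :: "'a::polish_space measure" and \<pi> :: "nat \<Rightarrow> ('a \<times> 'a) measure"
  assumes \<mu>: "borel_prob \<mu>" and \<nu>: "borel_prob \<nu>" and \<pi>: "\<And>k. \<pi> k \<in> couplings \<mu> \<nu>"
    and H: "Int_stable H" "UNIV \<in> H" "sigma_sets UNIV H = sets borel"
    and G: "algebra UNIV G" "countable G" "sigma_sets UNIV G = sets borel"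
    and HG: "\<And>A. A \<in> H \<Longrightarrow> A \<times> UNIV \<in> G" "\<And>A. A \<in> H \<Longrightarrow> UNIV \<times> A \<in> G"
    and rect: "\<And>A. A \<in> G \<Longrightarrow> \<exists>D. finite D \<and> D \<subseteq> sets borel \<times> sets borel \<and> A = (\<Union>(U, V)\<in>D. U \<times> V)"
  shows "\<exists>\<rho>\<in>couplings \<mu> \<nu>. \<exists>s. strict_mono s \<and> (\<forall>A\<in>G. (\<lambda>k. measure (\<pi> (s k)) A) \<longlonglongrightarrow> measure \<rho> A)"
proof -
  interpret G: algebra UNIV G by fact
  note c = couplingsD[OF \<pi>]
  have pr: "prob_space (\<pi> k)" for k by (rule c)
  have GB: "A \<in> sets (\<pi> k)" if "A \<in> G" for A k
    using G(3) that c(2) by (metis sigma_sets.Basic)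
  have HB: "A \<in> sets borel" if "A \<in> H" for A
    using H(3) that by (metis sigma_sets.Basic)
  obtain s where s: "strict_mono s" "\<And>A. A \<in> G \<Longrightarrow> convergent (\<lambda>k. measure (\<pi> (s k)) A)"
    using ex_convergent_subseq_on_countable[OF G(2), of "\<lambda>k. measure (\<pi> k)"] prob_space.prob_le_1[OF pr]
    by auto
  define l where "l A = lim (\<lambda>k. measure (\<pi> (s k)) A)" for A
  have l: "(\<lambda>k. measure (\<pi> (s k)) A) \<longlonglongrightarrow> l A" if "A \<in> G" for A
    using s(2)[OF that] by (simp add: convergent_LIMSEQ_iff l_def)
  have l_nn: "0 \<le> l A" if "A \<in> G" for A
    using l[OF that] by (rule LIMSEQ_le_const) auto
  have l_mono: "l A \<le> l B" if "A \<in> G" "B \<in> G" "A \<subseteq> B" for A B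
  proof (rule LIMSEQ_le[OF l l])
    show "\<exists>N. \<forall>n\<ge>N. measure (\<pi> (s n)) A \<le> measure (\<pi> (s n)) B"
      using that GB pr by (auto intro!: finite_measure.finite_measure_mono prob_space.finite_measure)
  qed (use that in auto)
  have l_add: "l (A \<union> B) = l A + l B" if "A \<in> G" "B \<in> G" "A \<inter> B = {}" for A B
  proof -
    have "(\<lambda>k. measure (\<pi> (s k)) (A \<union> B)) = (\<lambda>k. measure (\<pi> (s k)) A + measure (\<pi> (s k)) B)"
      using that GB pr
      by (auto intro!: finite_measure.finite_measure_Union prob_space.finite_measure)
    then have "(\<lambda>k. measure (\<pi> (s k)) (A \<union> B)) \<longlonglongrightarrow> l A + l B"
      using tendsto_add[OF l[OF that(1)] l[OF that(2)]] by simp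
    then show ?thesis using l[of "A \<union> B"] that LIMSEQ_unique by blast
  qed
  have l_empty: "l {} = 0"
    using l[OF G.empty_sets] by (simp add: LIMSEQ_const_iff)
  have "\<exists>m. (\<forall>A\<in>G. m A = ennreal (l A)) \<and> measure_space UNIV (sigma_sets UNIV G) m"
  proof (rule G.caratheodory_empty_continuous)
    show "positive G (\<lambda>A. ennreal (l A))" by (simp add: positive_def l_empty)
    show "additive G (\<lambda>A. ennreal (l A))"
      by (auto simp: additive_def l_add l_nn simp flip: ennreal_plus)
    fix A :: "nat \<Rightarrow> ('a \<times> 'a) set"
    assume A: "range A \<subseteq> G" "decseq A" "(\<Inter>i. A i) = {}"
    have AG: "A i \<in> G" for i using A by auto
    \<comment> \<open>All couplings have the same tight marginals, so the mass lost by shrinking the rectangles to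
      compact ones is controlled uniformly in the coupling.\<close>
    have small: "\<exists>n. l (A n) \<le> e" if e: "0 < e" for e
    proof -
      \<comment> \<open>Index \<open>i\<close> costs at most \<open>d i\<close> in each of the two
        marginals, and twice the sum of all \<open>d i\<close> is at most \<open>e\<close>.\<close>
      define d where "d i = e / 2 * (1 / 2) ^ Suc i" for i
      have "\<exists>C N N'. compact C \<and> C \<subseteq> A i \<and> N \<in> sets borel \<and> N' \<in> sets borel \<and>
          A i \<subseteq> C \<union> N \<times> UNIV \<union> UNIV \<times> N' \<and> measure \<mu> N < d i \<and> measure \<nu> N' < d i" for i
      proof -
        obtain D where D: "finite D" "D \<subseteq> sets borel \<times> sets borel" "A i = (\<Union>(U, V)\<in>D. U \<times> V)"
          using rect[OF AG[of i]] by (elim exE conjE)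
        have "0 < d i" using e by (simp add: d_def)
        from rectangles_inner_compact[OF \<mu> \<nu> D(1,2) this] show ?thesis unfolding D(3) .
      qed
      then obtain C N N' where C: "\<And>i. compact (C i)" "\<And>i. C i \<subseteq> A i"
        and N: "\<And>i. N i \<in> sets borel" "\<And>i. N' i \<in> sets borel"
        and ACN: "\<And>i. A i \<subseteq> C i \<union> N i \<times> UNIV \<union> UNIV \<times> N' i"
        and Nd: "\<And>i. measure \<mu> (N i) < d i" "\<And>i. measure \<nu> (N' i) < d i"
        by metis
      have "\<exists>n. (\<Inter>i\<le>n. C i) = {}"
      proof (rule ccontr)
        assume "\<not> ?thesis"
        then have *: "(\<Inter>i\<le>n. C i) \<noteq> {}" for n by blast
        \<comment> \<open>By the finite intersection property the compact sets would share a point,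
          which would lie in every \<open>A i\<close>.\<close>
        have "C 0 \<inter> (\<Inter>i\<in>UNIV. C i) \<noteq> {}"
        proof (rule compact_imp_fip_image[OF C(1) compact_imp_closed[OF C(1)]])
          fix J :: "nat set" assume "finite J"
          then obtain n where "J \<subseteq> {..n}" using finite_nat_iff_bounded_le by blast
          then have "(\<Inter>i\<le>n. C i) \<subseteq> C 0 \<inter> (\<Inter>i\<in>J. C i)" by auto
          then show "C 0 \<inter> (\<Inter>i\<in>J. C i) \<noteq> {}" using *[of n] by blast
        qed
        then obtain x where x: "\<And>i. x \<in> C i" by auto
        have "x \<in> (\<Inter>i. A i)" using subsetD[OF C(2) x] by simp
        then show False by (simp only: A(3) empty_iff)
      qed
      then obtain n where n: "(\<Inter>i\<le>n. C i) = {}" by blast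
      \<comment> \<open>A point of \<open>A n\<close> lies in all earlier \<open>A i\<close> because
        the sequence decreases, but it misses some \<open>C i\<close>, so it is in a strip of that
        index.\<close>
      have AN: "A n \<subseteq> (\<Union>i\<le>n. N i \<times> UNIV \<union> UNIV \<times> N' i)"
      proof
        fix p assume p: "p \<in> A n"
        from n obtain i where i: "i \<le> n" "p \<notin> C i" by auto
        have "p \<in> A i" using decseqD[OF A(2) i(1)] p by auto
        then show "p \<in> (\<Union>i\<le>n. N i \<times> UNIV \<union> UNIV \<times> N' i)"
          using ACN[of i] i by blast
      qed
      have NB: "N i \<times> UNIV \<union> UNIV \<times> N' i \<in> sets (\<pi> k)" for i k
        using N by (simp add: c(2) sets_borel_Times sets.Un)
      have "measure (\<pi> k) (A n) \<le> e" for k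
      proof -
        interpret prob_space "\<pi> k" by (rule pr)
        have "measure (\<pi> k) (A n) \<le> measure (\<pi> k) (\<Union>i\<le>n. N i \<times> UNIV \<union> UNIV \<times> N' i)"
          using NB AN by (intro finite_measure_mono) auto
        also have "\<dots> \<le> (\<Sum>i\<le>n. measure (\<pi> k) (N i \<times> UNIV \<union> UNIV \<times> N' i))"
          using NB by (intro finite_measure_subadditive_finite) auto
        also have "\<dots> \<le> (\<Sum>i\<le>n. measure \<mu> (N i) + measure \<nu> (N' i))"
        proof (rule sum_mono)
          fix i
          show "measure (\<pi> k) (N i \<times> UNIV \<union> UNIV \<times> N' i) \<le> measure \<mu> (N i) + measure \<nu> (N' i)"
            using measure_Un_le[of "N i \<times> UNIV" "\<pi> k" "UNIV \<times> N' i"] measure_coupling[OF \<pi>] N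
            by (simp add: c(2) sets_borel_Times)
        qed
        also have "\<dots> \<le> (\<Sum>i\<le>n. 2 * d i)"
          using Nd by (intro sum_mono) (smt (verit))
        also have "\<dots> = e * (\<Sum>i\<le>n. (1 / 2) ^ Suc i)"
          by (simp add: d_def sum_distrib_left)
        also have "(\<Sum>i\<le>n. (1 / 2 :: real) ^ Suc i) \<le> 1"
        proof -
          have "(\<Sum>i\<le>n. (1 / 2 :: real) ^ Suc i) = 1 - (1 / 2) ^ Suc n"
            by (induction n) auto
          then show ?thesis by simp
        qed
        finally show ?thesis using e by simp
      qed
      then have "l (A n) \<le> e"
        by (intro LIMSEQ_le_const2[OF l[OF AG]]) auto
      then show ?thesis by blast
    qed
    have "(\<lambda>i. l (A i)) \<longlonglongrightarrow> 0"
    proof (rule LIMSEQ_I)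
      fix r :: real assume r: "0 < r"
      obtain n where n: "l (A n) \<le> r / 2" using small[of "r / 2"] r by auto
      have "l (A m) \<le> r / 2" if "m \<ge> n" for m
        using l_mono[OF AG AG decseqD[OF A(2) that]] n by linarith
      then show "\<exists>n. \<forall>m\<ge>n. norm (l (A m) - 0) < r"
        using l_nn[OF AG] r by (intro exI[of _ n]) (auto simp: field_simps, smt (verit))
    qed
    then show "(\<lambda>i. ennreal (l (A i))) \<longlonglongrightarrow> 0"
      using tendsto_ennrealI by fastforce
  qed simp
  then obtain m where m: "\<And>A. A \<in> G \<Longrightarrow> m A = ennreal (l A)" "measure_space UNIV (sigma_sets UNIV G) m"
    by blast
  define \<rho> where "\<rho> = measure_of UNIV (sigma_sets UNIV G) m"
  have sets_\<rho>: "sets \<rho> = sets borel"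
    by (simp add: \<rho>_def G(3) sigma_sets_borel)
  have em: "emeasure \<rho> A = ennreal (l A)" if "A \<in> G" for A
  proof -
    have "emeasure \<rho> A = m A"
      unfolding \<rho>_def using m(2) that
      by (intro emeasure_measure_of_sigma) (auto simp: measure_space_def)
    then show ?thesis using m(1) that by simp
  qed
  have "\<rho> \<in> couplings \<mu> \<nu>"
  proof (rule couplingsI[OF \<mu> \<nu> sets_\<rho> _ _ H])
    fix A assume A: "A \<in> H"
    have "l (A \<times> UNIV) = measure \<mu> A" "l (UNIV \<times> A) = measure \<nu> A"
      using l[OF HG(1)[OF A]] l[OF HG(2)[OF A]] measure_coupling[OF \<pi> HB[OF A]]
      by (simp_all add: LIMSEQ_const_iff)
    then show "emeasure \<rho> (A \<times> UNIV) = emeasure \<mu> A" "emeasure \<rho> (UNIV \<times> A) = emeasure \<nu> A"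
      using em HG[OF A] borel_probD(1)[OF \<mu>] borel_probD(1)[OF \<nu>]
      by (simp_all add: finite_measure.emeasure_eq_measure prob_space.finite_measure)
  qed
  moreover have "measure \<rho> A = l A" if "A \<in> G" for A
    using em[OF that] l_nn[OF that] by (simp add: measure_def)
  ultimately show ?thesis using s(1) l by (intro bexI[of _ \<rho>] exI[of _ s]) auto
qed

section \<open>Duality for closed relations\<close>

lemma ex_basis_sequence:
  "\<exists>b :: nat \<Rightarrow> 'a::second_countable_topology set. topological_basis (range b)"
proof -
  obtain B :: "'a set set" where B: "countable B" "topological_basis B"
    using ex_countable_basis by auto
  then have "B \<noteq> {}"
    using topological_basisE[OF B(2) open_UNIV UNIV_I] by blast
  then show ?thesis using B range_from_nat_into by metis
qed

text \<open>
  The first \<open>n\<close> basis sets partition the space into finitely many cells; a cell is named by the set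
  of indices of the basis sets containing it.
\<close>
definition cell :: "(nat \<Rightarrow> 'a set) \<Rightarrow> nat \<Rightarrow> 'a \<Rightarrow> nat set" where
  "cell b n x = {i. i < n \<and> x \<in> b i}"

lemma cell_mono: "n \<le> m \<Longrightarrow> cell b n x = cell b m x \<inter> {..<n}"
  by (auto simp: cell_def)

lemma cell_subset: "cell b n x \<in> Pow {..<n}"
  by (auto simp: cell_def)

lemma finite_range_cell: "finite (range (cell b n))"
  by (rule finite_subset[of _ "Pow {..<n}"]) (auto simp: cell_def)

lemma vimage_cell_sets:
  assumes "\<And>i. open (b i)"
  shows "cell b n -` {z} \<in> sets borel"
proof (cases "z \<subseteq> {..<n}")
  case True
  then have "cell b n x = z \<longleftrightarrow> (\<forall>i\<in>{..<n}. x \<in> b i \<longleftrightarrow> i \<in> z)" for x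
    unfolding cell_def set_eq_iff mem_Collect_eq subset_iff lessThan_iff Ball_def by meson
  then have "cell b n -` {z} = {x \<in> space borel. \<forall>i\<in>{..<n}. x \<in> b i \<longleftrightarrow> i \<in> z}"
    unfolding vimage_def by simp
  also have "\<dots> \<in> sets borel"
  proof (intro sets.sets_Collect_finite_All)
    fix i assume "i \<in> {..<n}"
    have "{x \<in> space borel. x \<in> b i \<longleftrightarrow> i \<in> z} = (if i \<in> z then b i else - b i)" by auto
    then show "{x \<in> space borel. x \<in> b i \<longleftrightarrow> i \<in> z} \<in> sets borel"
      using assms by (auto intro: borel_comp)
  qed simp
  finally show ?thesis .
next
  case False
  then have "cell b n -` {z} = {}" by (auto simp: cell_def)
  then show ?thesis by simp
qed

text \<open>Sets of pairs that are decided by the level-\<open>n\<close> cells of both coordinates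
  for some \<open>n\<close>. Restricting \<open>T\<close> to possible cell names keeps every level
  finite, hence the union countable.\<close>

definition cell_algebra :: "(nat \<Rightarrow> 'a set) \<Rightarrow> ('a \<times> 'a) set set" where
  "cell_algebra b = (\<Union>n. (\<lambda>T. {p. (cell b n (fst p), cell b n (snd p)) \<in> T}) ` Pow (Pow {..<n} \<times> Pow {..<n}))"

lemma cell_algebraI: "{p. P (cell b n (fst p)) (cell b n (snd p))} \<in> cell_algebra b"
  unfolding cell_algebra_def
proof (intro UN_I[of n] image_eqI)
  show "{p. P (cell b n (fst p)) (cell b n (snd p))} =
    {p. (cell b n (fst p), cell b n (snd p)) \<in> {(u, v). u \<subseteq> {..<n} \<and> v \<subseteq> {..<n} \<and> P u v}}"
    using cell_subset[of b n] by auto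
qed auto

lemma cell_algebraE:
  assumes "A \<in> cell_algebra b"
  obtains n T where "T \<subseteq> Pow {..<n} \<times> Pow {..<n}" "A = {p. (cell b n (fst p), cell b n (snd p)) \<in> T}"
proof -
  from assms obtain n where "A \<in> (\<lambda>T. {p. (cell b n (fst p), cell b n (snd p)) \<in> T}) ` Pow (Pow {..<n} \<times> Pow {..<n})"
    unfolding cell_algebra_def by (elim UN_E)
  then show thesis using that[of _ n] by (elim imageE) blast
qed

lemma countable_cell_algebra: "countable (cell_algebra b)"
  unfolding cell_algebra_def
  by (rule countable_UN, simp, rule countable_finite, simp)

lemma algebra_cell_algebra: "algebra UNIV (cell_algebra b)"
  unfolding algebra_iff_Un
proof (intro conjI ballI)
  show "{} \<in> cell_algebra b"
    using cell_algebraI[of "\<lambda>_ _. False" b 0] by simp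
  fix A assume "A \<in> cell_algebra b"
  then obtain n T where A: "A = {p. (cell b n (fst p), cell b n (snd p)) \<in> T}"
    by (elim cell_algebraE)
  have "UNIV - A = {p. (cell b n (fst p), cell b n (snd p)) \<notin> T}" by (auto simp: A)
  then show "UNIV - A \<in> cell_algebra b"
    using cell_algebraI[of "\<lambda>u v. (u, v) \<notin> T" b n] by simp
  fix A' assume "A' \<in> cell_algebra b"
  then obtain n' T' where A': "A' = {p. (cell b n' (fst p), cell b n' (snd p)) \<in> T'}"
    by (elim cell_algebraE)
  \<comment> \<open>Finer cells determine coarser ones, so both sets are visible at the common level
    \<open>k\<close>.\<close>
  define k where "k = max n n'"
  have "n \<le> k" "n' \<le> k" by (simp_all add: k_def)
  then have "A \<union> A' = {p. (cell b k (fst p) \<inter> {..<n}, cell b k (snd p) \<inter> {..<n}) \<in> T \<or>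
      (cell b k (fst p) \<inter> {..<n'}, cell b k (snd p) \<inter> {..<n'}) \<in> T'}"
    unfolding A A' by (simp add: cell_mono[of n k] cell_mono[of n' k] Collect_disj_eq)
  also have "\<dots> \<in> cell_algebra b"
    by (rule cell_algebraI[of "\<lambda>u v. (u \<inter> {..<n}, v \<inter> {..<n}) \<in> T \<or> (u \<inter> {..<n'}, v \<inter> {..<n'}) \<in> T'"])
  finally show "A \<union> A' \<in> cell_algebra b" .
qed simp

lemma cell_algebra_rectangles:
  assumes b: "\<And>i. open (b i)" and "A \<in> cell_algebra b"
  shows "\<exists>D. finite D \<and> D \<subseteq> sets borel \<times> sets borel \<and> A = (\<Union>(U, V)\<in>D. U \<times> V)"
proof -
  obtain n T where T: "T \<subseteq> Pow {..<n} \<times> Pow {..<n}" and A: "A = {p. (cell b n (fst p), cell b n (snd p)) \<in> T}"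
    using assms(2) by (rule cell_algebraE)
  let ?D = "(\<lambda>(u, v). (cell b n -` {u}, cell b n -` {v})) ` T"
  have "finite T" using T by (rule finite_subset) simp
  moreover have "A = (\<Union>(U, V)\<in>?D. U \<times> V)"
  proof (rule set_eqI)
    fix p
    have "(u, v) \<in> T \<longleftrightarrow> (\<exists>q\<in>T. u = fst q \<and> v = snd q)" for u v by force
    then have "p \<in> A \<longleftrightarrow> (\<exists>q\<in>T. cell b n (fst p) = fst q \<and> cell b n (snd p) = snd q)"
      by (simp only: A mem_Collect_eq)
    then show "p \<in> A \<longleftrightarrow> p \<in> (\<Union>(U, V)\<in>?D. U \<times> V)"
      by (cases p) (simp add: case_prod_beta)
  qed
  ultimately show ?thesis
    using vimage_cell_sets[of b n, OF b] by (intro exI[of _ ?D]) auto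
qed

text \<open>Members are finite unions of Borel rectangles; conversely the algebra contains the
  products of basis sets, which form a countable basis of the product space.\<close>

lemma sigma_sets_cell_algebra:
  fixes b :: "nat \<Rightarrow> 'a::second_countable_topology set"
  assumes b: "topological_basis (range b)"
  shows "sigma_sets UNIV (cell_algebra b) = sets borel"
proof (rule antisym)
  have ob: "open (b i)" for i using topological_basis_open[OF b] by auto
  show "sigma_sets UNIV (cell_algebra b) \<subseteq> sets borel"
  proof (rule sets.sigma_sets_subset[of _ borel, simplified], rule subsetI)
    fix A assume A: "A \<in> cell_algebra b"
    obtain D where D: "finite D" "D \<subseteq> sets borel \<times> sets borel" "A = (\<Union>(U, V)\<in>D. U \<times> V)"
      using cell_algebra_rectangles[of b, OF ob A] by (elim exE conjE)
    show "A \<in> sets borel"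
      unfolding D(3) using D(1,2) by (intro sets.finite_UN) (auto intro: sets_borel_Times)
  qed
  let ?B = "(\<lambda>(A, B). A \<times> B) ` (range b \<times> range b)"
  have "topological_basis ?B" by (intro topological_basis_prod b)
  then have "sets borel = sigma_sets UNIV ?B"
    by (subst borel_eq_countable_basis[of ?B]) auto
  also have "\<dots> \<subseteq> sigma_sets UNIV (cell_algebra b)"
  proof (rule sigma_sets_subseteq, rule subsetI)
    fix A assume "A \<in> ?B"
    then obtain i j where A: "A = b i \<times> b j" by auto
    \<comment> \<open>Level \<open>n\<close> only sees indices below \<open>n\<close>, hence the
      successor.\<close>
    have "A = {p. i \<in> cell b (Suc (max i j)) (fst p) \<and> j \<in> cell b (Suc (max i j)) (snd p)}"
      by (auto simp: A cell_def)
    also have "\<dots> \<in> cell_algebra b"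
      by (rule cell_algebraI[of "\<lambda>u v. i \<in> u \<and> j \<in> v"])
    finally show "A \<in> cell_algebra b" .
  qed
  finally show "sets borel \<subseteq> sigma_sets UNIV (cell_algebra b)" .
qed

text \<open>The couplings for the level-\<open>n\<close> partitions control only a coarse
  enlargement of \<open>F\<close>. A set of the algebra disjoint from \<open>F\<close> avoids these
  enlargements from some level on, so the limit gives it mass at most \<beta>. As \<open>F\<close>
  is closed, its complement is an increasing union of such sets.\<close>

lemma closed_strassen:
  fixes \<mu> \<nu> :: "'a::polish_space measure"
  assumes \<mu>: "borel_prob \<mu>" and \<nu>: "borel_prob \<nu>" and F: "closed F"
    and cut: "\<And>A B. A \<in> sets borel \<Longrightarrow> B \<in> sets borel \<Longrightarrow> F `` A \<subseteq> B \<Longrightarrow> measure \<mu> A \<le> measure \<nu> B + \<beta>"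
  shows "\<exists>\<pi>\<in>couplings \<mu> \<nu>. 1 - measure \<pi> F \<le> \<beta>"
proof -
  obtain b :: "nat \<Rightarrow> 'a set" where b: "topological_basis (range b)"
    using ex_basis_sequence by (elim exE)
  have ob: "open (b i)" for i using topological_basis_open[OF b] by auto
  let ?G = "cell_algebra b"
  define H where "H = {A. A \<times> UNIV \<in> ?G \<and> UNIV \<times> A \<in> ?G}"
  interpret G: algebra UNIV ?G by (rule algebra_cell_algebra)
  have Int_H: "Int_stable H"
  proof (rule Int_stableI)
    fix A B assume "A \<in> H" "B \<in> H"
    moreover have "(A \<inter> B) \<times> UNIV = A \<times> UNIV \<inter> B \<times> UNIV" "UNIV \<times> (A \<inter> B) = UNIV \<times> A \<inter> UNIV \<times> B" by auto
    ultimately show "A \<inter> B \<in> H" unfolding H_def mem_Collect_eq by (metis G.Int)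
  qed
  have GB: "A \<in> sets borel" if "A \<in> ?G" for A
    using sigma_sets_cell_algebra[OF b] that by (metis sigma_sets.Basic)
  have bH: "range b \<subseteq> H"
  proof safe
    fix i
    have "b i \<times> UNIV = {p. i \<in> cell b (Suc i) (fst p)}" by (auto simp: cell_def)
    also have "\<dots> \<in> ?G" by (rule cell_algebraI[of "\<lambda>u v. i \<in> u"])
    finally have 1: "b i \<times> UNIV \<in> ?G" .
    have "UNIV \<times> b i = {p. i \<in> cell b (Suc i) (snd p)}" by (auto simp: cell_def)
    also have "\<dots> \<in> ?G" by (rule cell_algebraI[of "\<lambda>u v. i \<in> v"])
    finally show "b i \<in> H" using 1 by (simp add: H_def)
  qed
  have HB: "A \<in> sets borel" if "A \<in> H" for A
  proof -
    \<comment> \<open>\<open>A\<close> is a section of its Borel cylinder, taken at an arbitrary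
      second coordinate.\<close>
    have "A \<times> (UNIV :: 'a set) \<in> sets borel" using that GB by (simp add: H_def)
    moreover have "(\<lambda>x. (x, undefined)) \<in> measurable borel (borel :: ('a \<times> 'a) measure)"
      by (intro borel_measurable_continuous_onI continuous_intros)
    ultimately have "(\<lambda>x. (x, undefined)) -` (A \<times> (UNIV :: 'a set)) \<in> sets borel"
      using measurable_sets by (metis space_borel inf_top.right_neutral)
    moreover have "(\<lambda>x. (x, undefined)) -` (A \<times> (UNIV :: 'a set)) = A" by auto
    ultimately show ?thesis by simp
  qed
  have sigma_H: "sigma_sets UNIV H = sets borel"
  proof (rule antisym)
    show "sigma_sets UNIV H \<subseteq> sets borel"
      using sets.sigma_sets_subset[of H borel] HB by auto
    have "sets borel = sigma_sets UNIV (range b)"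
      by (subst borel_eq_countable_basis[of "range b"]) (auto simp: b)
    then show "sets borel \<subseteq> sigma_sets UNIV H"
      using sigma_sets_mono'[OF bH] by simp
  qed
  have "\<exists>\<pi>\<in>couplings \<mu> \<nu>. measure \<pi> {(x, y). (cell b n x, cell b n y) \<notin> map_prod (cell b n) (cell b n) ` F} \<le> \<beta>" for n
    by (rule finite_partition_coupling[OF \<mu> \<nu> vimage_cell_sets[of b, OF ob] finite_range_cell cut])
  then have "\<forall>n. \<exists>\<pi>. \<pi> \<in> couplings \<mu> \<nu> \<and> measure \<pi> {(x, y). (cell b n x, cell b n y) \<notin> map_prod (cell b n) (cell b n) ` F} \<le> \<beta>"
    by blast
  then obtain \<pi> where \<pi>: "\<And>n. \<pi> n \<in> couplings \<mu> \<nu>"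
    and \<pi>F: "\<And>n. measure (\<pi> n) {(x, y). (cell b n x, cell b n y) \<notin> map_prod (cell b n) (cell b n) ` F} \<le> \<beta>"
    by metis
  have "\<exists>\<rho>\<in>couplings \<mu> \<nu>. \<exists>s. strict_mono s \<and> (\<forall>A\<in>?G. (\<lambda>k. measure (\<pi> (s k)) A) \<longlonglongrightarrow> measure \<rho> A)"
  proof (rule couplings_limit[OF \<mu> \<nu> \<pi> Int_H _ sigma_H algebra_cell_algebra countable_cell_algebra
        sigma_sets_cell_algebra[OF b] _ _ cell_algebra_rectangles[of b, OF ob]])
    show "UNIV \<in> H" using G.top by (simp add: H_def)
  qed (simp_all add: H_def)
  then obtain \<rho> s where \<rho>: "\<rho> \<in> couplings \<mu> \<nu>" and s: "strict_mono s"
    and lim_all: "\<forall>A\<in>?G. (\<lambda>k. measure (\<pi> (s k)) A) \<longlonglongrightarrow> measure \<rho> A"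
    by (elim bexE exE conjE)
  note lim = bspec[OF lim_all]
  interpret \<rho>: prob_space \<rho> by (rule couplingsD[OF \<rho>])
  have le: "measure \<rho> A \<le> \<beta>" if A: "A \<in> ?G" "A \<inter> F = {}" for A
  proof -
    obtain n T where AT: "A = {p. (cell b n (fst p), cell b n (snd p)) \<in> T}"
      using A(1) by (elim cell_algebraE)
    have "measure (\<pi> (s k)) A \<le> \<beta>" if "n \<le> k" for k
    proof -
      have n: "n \<le> s k" using that seq_suble[OF s, of k] by linarith
      \<comment> \<open>A point of \<open>F\<close> with the same cells as \<open>p\<close> at level
        \<open>s k\<close> also shares its cells at the coarser level \<open>n\<close>, so it would
        lie in \<open>A\<close>.\<close>
      have "A \<subseteq> {(x, y). (cell b (s k) x, cell b (s k) y) \<notin> map_prod (cell b (s k)) (cell b (s k)) ` F}"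
      proof (rule subsetI)
        fix p assume p: "p \<in> A"
        obtain x y where xy: "p = (x, y)" by (cases p)
        have "(cell b (s k) x, cell b (s k) y) \<notin> map_prod (cell b (s k)) (cell b (s k)) ` F"
        proof
          assume "(cell b (s k) x, cell b (s k) y) \<in> map_prod (cell b (s k)) (cell b (s k)) ` F"
          then obtain q where q: "q \<in> F" "(cell b (s k) x, cell b (s k) y) = map_prod (cell b (s k)) (cell b (s k)) q"
            by (elim imageE)
          have "cell b n x = cell b n (fst q)" "cell b n y = cell b n (snd q)"
            using q(2) by (simp_all add: cell_mono[OF n] map_prod_def case_prod_beta)
          then have "q \<in> A" using p by (simp add: AT xy)
          then show False using A(2) q(1) by auto
        qed
        then show "p \<in> {(x, y). (cell b (s k) x, cell b (s k) y) \<notin> map_prod (cell b (s k)) (cell b (s k)) ` F}"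
          by (simp add: xy)
      qed
      moreover have "{(x, y). (cell b (s k) x, cell b (s k) y) \<notin> map_prod (cell b (s k)) (cell b (s k)) ` F} \<in> ?G"
        using cell_algebraI[of "\<lambda>u v. (u, v) \<notin> map_prod (cell b (s k)) (cell b (s k)) ` F" b "s k"]
        by (simp add: case_prod_unfold)
      ultimately have "measure (\<pi> (s k)) A \<le> measure (\<pi> (s k)) {(x, y). (cell b (s k) x, cell b (s k) y) \<notin> map_prod (cell b (s k)) (cell b (s k)) ` F}"
        using couplingsD[OF \<pi>] GB
        by (intro finite_measure.finite_measure_mono prob_space.finite_measure) auto
      then show ?thesis using \<pi>F[of "s k"] by linarith
    qed
    then show ?thesis by (intro LIMSEQ_le_const2[OF lim[OF A(1)]]) auto
  qed
  let ?B = "(\<lambda>(A, B). A \<times> B) ` (range b \<times> range b)"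
  have B: "topological_basis ?B" by (intro topological_basis_prod b)
  have BG: "?B \<subseteq> ?G"
  proof
    fix A assume "A \<in> ?B"
    then obtain i j where "A = b i \<times> b j" by auto
    then have "A = b i \<times> UNIV \<inter> UNIV \<times> b j" by auto
    then show "A \<in> ?G" using bH by (auto simp: H_def)
  qed
  obtain B' where B': "B' \<subseteq> ?B" "\<Union>B' = - F"
    using B F unfolding topological_basis_def by (metis open_Compl)
  have "countable B'" using B'(1) by (rule countable_subset) simp
  \<comment> \<open>The empty set is inserted because an enumeration needs a nonempty family, and
    \<open>B'\<close> may be empty when \<open>F\<close> is the whole space.\<close>
  define g where "g = from_nat_into (insert {} B')"
  have rg: "range g = insert {} B'"
    unfolding g_def using \<open>countable B'\<close> by (intro range_from_nat_into) auto
  define A where "A n = (\<Union>i<n. g i)" for n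
  have gG: "g i \<in> ?G" for i
    using rg B' BG G.empty_sets by (metis (no_types, lifting) insert_iff rangeI subset_iff)
  have AG: "A n \<in> ?G" for n unfolding A_def using gG by (intro G.finite_UN) auto
  have "(\<Union>n. A n) = \<Union>(range g)" by (auto simp: A_def)
  then have UA: "(\<Union>n. A n) = - F" using B' rg by simp
  have "(\<lambda>n. measure \<rho> (A n)) \<longlonglongrightarrow> measure \<rho> (\<Union>n. A n)"
  proof (rule \<rho>.finite_Lim_measure_incseq)
    show "range A \<subseteq> sets \<rho>" using AG GB couplingsD(2)[OF \<rho>] by auto
    show "incseq A" unfolding incseq_def A_def by (intro allI impI UN_mono) auto
  qed
  moreover have "measure \<rho> (A n) \<le> \<beta>" for n
    using AG UA by (intro le) auto
  ultimately have "measure \<rho> (- F) \<le> \<beta>"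
    unfolding UA by (intro LIMSEQ_le_const2) auto
  moreover have "measure \<rho> (- F) = 1 - measure \<rho> F"
    using \<rho>.prob_compl[of F] F couplingsD(2,3)[OF \<rho>] by (simp add: Compl_eq_Diff_UNIV)
  ultimately show ?thesis using \<rho> by auto
qed

section \<open>Duality for \<open>F\<^sub>\<sigma>\<close> preorders\<close>

text \<open>Weak duality: a pair with first coordinate in \<open>A\<close> either has its second
  coordinate in \<open>B\<close> or lies outside \<open>F\<close>.\<close>

lemma cut_le_coupling:
  fixes \<mu> \<nu> :: "'a::second_countable_topology measure"
  assumes \<pi>: "\<pi> \<in> couplings \<mu> \<nu>" and F: "F \<in> sets borel"
    and A: "A \<in> sets borel" "B \<in> sets borel" "F `` A \<subseteq> B"
  shows "measure \<mu> A - measure \<nu> B \<le> 1 - measure \<pi> F"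
proof -
  interpret prob_space \<pi> by (rule couplingsD[OF \<pi>])
  note s = couplingsD(2,3)[OF \<pi>]
  have "measure \<mu> A = measure \<pi> (A \<times> UNIV)"
    using measure_coupling[OF \<pi> A(1)] by simp
  also have "\<dots> \<le> measure \<pi> (UNIV \<times> B \<union> - F)"
    using A F by (intro finite_measure_mono) (auto simp: s sets_borel_Times borel_comp intro!: sets.Un)
  also have "\<dots> \<le> measure \<pi> (UNIV \<times> B) + measure \<pi> (- F)"
    using A F by (intro measure_Un_le) (auto simp: s sets_borel_Times borel_comp)
  also have "\<dots> = measure \<nu> B + (1 - measure \<pi> F)"
    using measure_coupling[OF \<pi> A(2)] prob_compl[of F] F by (simp add: s Compl_eq_Diff_UNIV)
  finally show ?thesis by simp
qed

text \<open>With \<beta> = 1 the cut condition is trivial. Nonemptiness makes the real infimum over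
  couplings meaningful.\<close>

lemma couplings_nonempty:
  fixes \<mu> \<nu> :: "'a::polish_space measure"
  assumes \<mu>: "borel_prob \<mu>" and \<nu>: "borel_prob \<nu>"
  shows "couplings \<mu> \<nu> \<noteq> {}"
proof -
  have "measure \<mu> A \<le> measure \<nu> B + 1" for A B
    using prob_space.prob_le_1[OF borel_probD(1)[OF \<mu>], of A] by (simp add: add_increasing)
  then show ?thesis using closed_strassen[OF \<mu> \<nu> closed_UNIV, of 1] by blast
qed

lemma bdd_below_coupling_cost: "bdd_below ((\<lambda>\<pi>. 1 - measure \<pi> R) ` couplings \<mu> \<nu>)"
proof (rule bdd_belowI2[where m = 0])
  fix \<pi> assume "\<pi> \<in> couplings \<mu> \<nu>"
  then show "0 \<le> 1 - measure \<pi> R"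
    using prob_space.prob_le_1[OF couplingsD(1)] by simp
qed

text \<open>For a convergent sequence in the image, compactness yields a convergent subsequence of
  preimages in \<open>C\<close>, and the limit pair stays in \<open>F\<close>.\<close>

lemma closed_Image_compact:
  fixes F :: "('a::metric_space \<times> 'b::metric_space) set"
  assumes F: "closed F" and C: "compact C"
  shows "closed (F `` C)"
  unfolding closed_sequential_limits
proof (intro allI impI, elim conjE)
  fix y l assume y: "\<forall>n. y n \<in> F `` C" and yl: "y \<longlonglongrightarrow> l"
  then have "\<forall>n. \<exists>x. x \<in> C \<and> (x, y n) \<in> F" by blast
  then obtain x where x: "\<forall>n. x n \<in> C" "\<And>n. (x n, y n) \<in> F" by metis
  obtain x0 r where r: "x0 \<in> C" "strict_mono r" "(x \<circ> r) \<longlonglongrightarrow> x0"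
    using seq_compactE[OF compact_imp_seq_compact[OF C] x(1)] .
  have "(\<lambda>n. ((x \<circ> r) n, (y \<circ> r) n)) \<longlonglongrightarrow> (x0, l)"
    using r LIMSEQ_subseq_LIMSEQ[OF yl] by (intro tendsto_Pair)
  then have "(x0, l) \<in> F"
    using x(2) by (intro closed_sequentially[OF F _ \<open>_ \<longlonglongrightarrow> (x0, l)\<close>]) simp
  then show "l \<in> F `` C" using r(1) by blast
qed

lemma inner_sigma_compact:
  fixes \<mu> :: "'a::polish_space measure"
  assumes \<mu>: "borel_prob \<mu>" and D: "D \<in> sets borel"
  shows "\<exists>C :: nat \<Rightarrow> 'a set. (\<forall>n. compact (C n)) \<and> (\<Union>n. C n) \<subseteq> D \<and> measure \<mu> D \<le> measure \<mu> (\<Union>n. C n)"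
proof -
  interpret M: prob_space \<mu> by (rule borel_probD[OF \<mu>])
  note s = borel_probD(2)[OF \<mu>]
  have "\<forall>n. \<exists>K. compact K \<and> K \<subseteq> D \<and> measure \<mu> (D - K) < inverse (real (Suc n))"
    using inner_regular_diff[OF \<mu> D] by simp
  then obtain C where C: "\<And>n. compact (C n)" "\<And>n. C n \<subseteq> D"
    "\<And>n. measure \<mu> (D - C n) < inverse (real (Suc n))" by metis
  have CB: "C n \<in> sets borel" for n using C(1) by (rule borel_compact)
  have "measure \<mu> D - measure \<mu> (\<Union>n. C n) \<le> inverse (real (Suc n))" for n
  proof -
    have "measure \<mu> (D - C n) = measure \<mu> D - measure \<mu> (C n)"
      using D C(2) CB s by (intro M.finite_measure_Diff) auto
    moreover have "measure \<mu> (C n) \<le> measure \<mu> (\<Union>n. C n)"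
      using CB s by (intro M.finite_measure_mono) auto
    ultimately show ?thesis using C(3)[of n] by linarith
  qed
  then have "measure \<mu> D - measure \<mu> (\<Union>n. C n) \<le> 0"
    by (intro LIMSEQ_le_const[OF LIMSEQ_inverse_real_of_nat]) auto
  then show ?thesis using C by (intro exI[of _ C]) auto
qed

text \<open>Near-optimal cuts for the closed sets \<open>K n\<close> have values tending to
  \<gamma>; their upper limits form a cut for the whole of \<open>R\<close> without loss of
  value.\<close>

lemma fsigma_optimal_cut:
  fixes \<mu> \<nu> :: "'a::polish_space measure"
  assumes \<mu>: "borel_prob \<mu>" and \<nu>: "borel_prob \<nu>"
    and K: "\<And>n. closed (K n)" "incseq K" and R: "R = (\<Union>n. K n)"
  shows "\<exists>D\<in>sets borel. \<exists>B\<in>sets borel. R `` D \<subseteq> B \<and>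
    (INF \<pi>\<in>couplings \<mu> \<nu>. 1 - measure \<pi> R) \<le> measure \<mu> D - measure \<nu> B"
proof -
  interpret M: prob_space \<mu> by (rule borel_probD[OF \<mu>])
  interpret N: prob_space \<nu> by (rule borel_probD[OF \<nu>])
  note s[simp] = borel_probD(2)[OF \<mu>] borel_probD(2)[OF \<nu>]
  define \<gamma> where "\<gamma> = (INF \<pi>\<in>couplings \<mu> \<nu>. 1 - measure \<pi> R)"
  have KB: "K n \<in> sets borel" for n using K(1) by (rule borel_closed)
  have RB: "R \<in> sets borel" unfolding R using KB by auto
  define cut where "cut k A B \<longleftrightarrow> A \<in> sets borel \<and> B \<in> sets borel \<and> K k `` A \<subseteq> B" for k A B
  have cut_mono: "cut k A B" if "cut m A B" "k \<le> m" for k m A B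
    using that incseqD[OF K(2) that(2)] by (auto simp: cut_def)
  define \<Phi> where "\<Phi> A B = measure \<mu> A - measure \<nu> B" for A B
  \<comment> \<open>A near-optimal coupling for \<open>R\<close> charges \<open>K n\<close> almost
    as much as \<open>R\<close> once \<open>n\<close> is large; weak duality then bounds every
    cut.\<close>
  have upper: "\<exists>N. \<forall>k\<ge>N. \<forall>A B. cut k A B \<longrightarrow> \<Phi> A B < \<gamma> + e" if e: "0 < e" for e
  proof -
    have "Inf ((\<lambda>\<pi>. 1 - measure \<pi> R) ` couplings \<mu> \<nu>) < \<gamma> + e" using e by (simp add: \<gamma>_def)
    then obtain \<pi> where \<pi>: "\<pi> \<in> couplings \<mu> \<nu>" "1 - measure \<pi> R < \<gamma> + e"
      using couplings_nonempty[OF \<mu> \<nu>] by (subst (asm) cINF_less_iff[OF _ bdd_below_coupling_cost]) auto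
    interpret prob_space \<pi> by (rule couplingsD[OF \<pi>(1)])
    have "(\<lambda>n. measure \<pi> (K n)) \<longlonglongrightarrow> measure \<pi> R"
      unfolding R using KB couplingsD(2)[OF \<pi>(1)] by (intro finite_Lim_measure_incseq K(2)) auto
    moreover have "1 - (\<gamma> + e) < measure \<pi> R" using \<pi>(2) by simp
    ultimately have "\<forall>\<^sub>F n in sequentially. 1 - (\<gamma> + e) < measure \<pi> (K n)"
      by (rule order_tendstoD)
    then obtain N where N: "\<And>n. n \<ge> N \<Longrightarrow> 1 - (\<gamma> + e) < measure \<pi> (K n)"
      by (auto simp: eventually_sequentially)
    have "\<Phi> A B < \<gamma> + e" if "k \<ge> N" "cut k A B" for k A B
      using cut_le_coupling[OF \<pi>(1) KB, of A B k] N[OF that(1)] that(2) by (simp add: cut_def \<Phi>_def)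
    then show ?thesis by blast
  qed
  \<comment> \<open>Otherwise the closed case would give a coupling with cost below \<gamma> already
    for \<open>K k\<close>, a subset of \<open>R\<close>.\<close>
  have lower: "\<exists>A B. cut k A B \<and> \<gamma> - e < \<Phi> A B" if e: "0 < e" for k e
  proof (rule ccontr)
    assume "\<not> ?thesis"
    then have "\<Phi> A B \<le> \<gamma> - e" if "cut k A B" for A B using that by (meson not_less)
    then obtain \<pi> where \<pi>: "\<pi> \<in> couplings \<mu> \<nu>" "1 - measure \<pi> (K k) \<le> \<gamma> - e"
      using closed_strassen[OF \<mu> \<nu> K(1), of k "\<gamma> - e"]
      by (force simp: cut_def \<Phi>_def diff_le_eq add.commute)
    interpret prob_space \<pi> by (rule couplingsD[OF \<pi>(1)])
    have "measure \<pi> (K k) \<le> measure \<pi> R"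
      using RB couplingsD(2)[OF \<pi>(1)] by (intro finite_measure_mono) (auto simp: R)
    moreover have "\<gamma> \<le> 1 - measure \<pi> R"
      unfolding \<gamma>_def by (rule cINF_lower[OF bdd_below_coupling_cost \<pi>(1)])
    ultimately show False using \<pi>(2) e by linarith
  qed
  define \<epsilon> where "\<epsilon> n = (1 / 2 :: real) ^ n" for n
  have \<epsilon>: "0 < \<epsilon> n" "\<epsilon> (Suc n) = \<epsilon> n / 2" for n by (simp_all add: \<epsilon>_def)
  have "\<forall>n. \<exists>N. \<forall>k\<ge>N. \<forall>A B. cut k A B \<longrightarrow> \<Phi> A B < \<gamma> + \<epsilon> n" using upper \<epsilon>(1) by blast
  then obtain N where N: "\<And>n k A B. N n \<le> k \<Longrightarrow> cut k A B \<Longrightarrow> \<Phi> A B < \<gamma> + \<epsilon> n" by metis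
  \<comment> \<open>One choice that is monotone and dominates both \<open>n\<close> and
    \<open>N n\<close>.\<close>
  define m where "m n = n + (\<Sum>i\<le>n. N i)" for n
  have m: "n \<le> m n" "N n \<le> m n" for n
    by (auto simp: m_def intro!: trans_le_add2 member_le_sum)
  have m_Suc: "m n \<le> m (Suc n)" for n by (simp add: m_def)
  have "\<forall>n. \<exists>A B. cut (m n) A B \<and> \<gamma> - \<epsilon> n < \<Phi> A B" using lower \<epsilon>(1) by blast
  then obtain A B where AB: "\<And>n. cut (m n) (A n) (B n)" "\<And>n. \<gamma> - \<epsilon> n < \<Phi> (A n) (B n)"
    by metis
  have A: "A n \<in> sets borel" and B: "B n \<in> sets borel" for n using AB(1) by (auto simp: cut_def)
  \<comment> \<open>Cuts form a lattice on which \<open>\<Phi>\<close> is modular: since meets exceed the optimum by at most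
    \<open>\<epsilon> n\<close>, joins of near-optimal cuts stay near-optimal.\<close>
  have modular: "\<Phi> (X \<union> X') (Y \<union> Y') = \<Phi> X Y + \<Phi> X' Y' - \<Phi> (X \<inter> X') (Y \<inter> Y')"
    if "X \<in> sets borel" "X' \<in> sets borel" "Y \<in> sets borel" "Y' \<in> sets borel" for X X' Y Y'
    using that measure_Un3[of X \<mu> X'] measure_Un3[of Y \<nu> Y']
    by (simp add: \<Phi>_def M.fmeasurable_eq_sets N.fmeasurable_eq_sets)
  \<comment> \<open>A cut for a later \<open>K\<close> is also one for an earlier \<open>K\<close>,
    so the join is a cut at level \<open>m n\<close>. The constant 4 reproduces itself: the errors
    add up to \<open>\<epsilon> n + 4 * \<epsilon> (Suc n) + \<epsilon> n\<close>, which is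
    \<open>4 * \<epsilon> n\<close>.\<close>
  have tail: "cut (m n) (\<Union>i\<in>{n..n+l}. A i) (\<Union>i\<in>{n..n+l}. B i) \<and>
      \<gamma> - 4 * \<epsilon> n \<le> \<Phi> (\<Union>i\<in>{n..n+l}. A i) (\<Union>i\<in>{n..n+l}. B i)" for n l
  proof (induction l arbitrary: n)
    case 0
    show ?case using AB[of n] \<epsilon>(1)[of n] by simp
  next
    case (Suc l)
    let ?X = "\<Union>i\<in>{Suc n..Suc n+l}. A i" and ?Y = "\<Union>i\<in>{Suc n..Suc n+l}. B i"
    have eq: "{n..n + Suc l} = insert n {Suc n..Suc n+l}" by auto
    have X: "(\<Union>i\<in>{n..n + Suc l}. A i) = A n \<union> ?X" and Y: "(\<Union>i\<in>{n..n + Suc l}. B i) = B n \<union> ?Y"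
      unfolding eq by simp_all
    have c: "cut (m n) ?X ?Y" using Suc.IH[of "Suc n"] cut_mono m_Suc by blast
    have "cut (m n) (A n \<inter> ?X) (B n \<inter> ?Y)"
      using c AB(1)[of n] unfolding cut_def by blast
    then have "\<Phi> (A n \<inter> ?X) (B n \<inter> ?Y) < \<gamma> + \<epsilon> n" by (rule N[OF m(2)])
    moreover have "\<Phi> (A n \<union> ?X) (B n \<union> ?Y) = \<Phi> (A n) (B n) + \<Phi> ?X ?Y - \<Phi> (A n \<inter> ?X) (B n \<inter> ?Y)"
      using c A B by (intro modular) (auto simp: cut_def)
    ultimately have "\<gamma> - 4 * \<epsilon> n \<le> \<Phi> (A n \<union> ?X) (B n \<union> ?Y)"
      using AB(2)[of n] Suc.IH[of "Suc n"] \<epsilon>(2)[of n] by linarith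
    moreover have "cut (m n) (A n \<union> ?X) (B n \<union> ?Y)"
      using c AB(1)[of n] unfolding cut_def by blast
    ultimately show ?case unfolding X Y by blast
  qed
  define DA where "DA n = (\<Union>i\<in>{n..}. A i)" for n
  define DB where "DB n = (\<Union>i\<in>{n..}. B i)" for n
  have DAB: "DA n \<in> sets borel" "DB n \<in> sets borel" for n
    unfolding DA_def DB_def using A B by auto
  have UN_tail: "(\<Union>l. \<Union>i\<in>{n..n+l}. X i) = (\<Union>i\<in>{n..}. X i)" for n and X :: "nat \<Rightarrow> 'a set"
  proof -
    have "{n..} = (\<Union>l. {n..n+l})" by (auto simp: atLeast_def) (metis le_add_diff_inverse le_refl)
    then show ?thesis by auto
  qed
  have incseq_tail: "incseq (\<lambda>l. \<Union>i\<in>{n..n+l}. X i)" for n and X :: "nat \<Rightarrow> 'a set"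
    by (intro incseq_SucI UN_mono) auto
  have D_ge: "\<gamma> - 4 * \<epsilon> n \<le> \<Phi> (DA n) (DB n)" for n
  proof -
    have "(\<lambda>l. measure \<mu> (\<Union>i\<in>{n..n+l}. A i)) \<longlonglongrightarrow> measure \<mu> (\<Union>l. \<Union>i\<in>{n..n+l}. A i)"
      using A by (intro M.finite_Lim_measure_incseq) (auto intro: incseq_tail)
    moreover have "(\<lambda>l. measure \<nu> (\<Union>i\<in>{n..n+l}. B i)) \<longlonglongrightarrow> measure \<nu> (\<Union>l. \<Union>i\<in>{n..n+l}. B i)"
      using B by (intro N.finite_Lim_measure_incseq) (auto intro: incseq_tail)
    ultimately have "(\<lambda>l. \<Phi> (\<Union>i\<in>{n..n+l}. A i) (\<Union>i\<in>{n..n+l}. B i)) \<longlonglongrightarrow> \<Phi> (DA n) (DB n)"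
      unfolding \<Phi>_def UN_tail DA_def DB_def by (rule tendsto_diff)
    then show ?thesis using tail by (intro LIMSEQ_le_const) auto
  qed
  have decseq_tail: "decseq (\<lambda>n. \<Union>i\<in>{n..}. X i)" for X :: "nat \<Rightarrow> 'a set"
    unfolding decseq_def by (intro allI impI UN_mono) auto
  define D where "D = (\<Inter>n. DA n)"
  define E where "E = (\<Inter>n. DB n)"
  have DE: "D \<in> sets borel" "E \<in> sets borel" unfolding D_def E_def using DAB by auto
  have "(\<lambda>n. measure \<mu> (DA n)) \<longlonglongrightarrow> measure \<mu> D"
    unfolding D_def using DAB decseq_tail[of A] by (intro M.finite_Lim_measure_decseq) (auto simp flip: DA_def)
  moreover have "(\<lambda>n. measure \<nu> (DB n)) \<longlonglongrightarrow> measure \<nu> E"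
    unfolding E_def using DAB decseq_tail[of B] by (intro N.finite_Lim_measure_decseq) (auto simp flip: DB_def)
  ultimately have "(\<lambda>n. \<Phi> (DA n) (DB n)) \<longlonglongrightarrow> \<Phi> D E"
    unfolding \<Phi>_def by (rule tendsto_diff)
  moreover have "(\<lambda>n. \<gamma> - 4 * \<epsilon> n) \<longlonglongrightarrow> \<gamma> - 4 * 0"
    unfolding \<epsilon>_def by (intro tendsto_intros) auto
  ultimately have "\<gamma> \<le> \<Phi> D E"
    using LIMSEQ_le D_ge by (metis (no_types, lifting) diff_zero mult_zero_right)
  moreover have "R `` D \<subseteq> E"
  proof
    \<comment> \<open>A point of \<open>D\<close> lies in \<open>A i\<close> for arbitrarily large
      \<open>i\<close>; as soon as \<open>i\<close> is at least \<open>j\<close>, the pair is in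
      \<open>K (m i)\<close> and hence \<open>y\<close> is in \<open>B i\<close>.\<close>
    fix y assume "y \<in> R `` D"
    then obtain x j where x: "x \<in> D" "(x, y) \<in> K j" by (auto simp: R)
    have "y \<in> DB n" for n
    proof -
      have "x \<in> DA (max n j)" using x by (auto simp: D_def)
      then obtain i where i: "i \<ge> max n j" "x \<in> A i" by (auto simp: DA_def)
      have "j \<le> m i" using i m(1)[of i] by linarith
      then have "(x, y) \<in> K (m i)" using x(2) incseqD[OF K(2)] by blast
      then have "y \<in> B i" using AB(1)[of i] i(2) by (auto simp: cut_def)
      then show ?thesis using i by (auto simp: DB_def)
    qed
    then show "y \<in> E" by (simp add: E_def)
  qed
  ultimately show ?thesis using DE unfolding \<gamma>_def \<Phi>_def by blast
qed

text \<open>The optimal two-set cut is turned into an upset \<open>U\<close>: transitivity closes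
  \<open>U\<close> under \<open>R\<close>, reflexivity keeps its \<mu>-mass at least that of
  \<open>D\<close>, and \<open>U\<close> lies in \<open>B\<close>, which bounds its
  \<nu>-mass.\<close>

theorem fsigma_strassen:
  fixes R :: "('a::polish_space \<times> 'a) set" and \<mu> \<nu> :: "'a measure"
  assumes "refl R" and "trans R" and "fsigma_in euclidean R"
    and \<mu>: "borel_prob \<mu>" and \<nu>: "borel_prob \<nu>"
  shows "\<exists>A\<in>upsets R.
            (\<forall>B\<in>upsets R. measure \<mu> B - measure \<nu> B \<le> measure \<mu> A - measure \<nu> A) \<and>
            measure \<mu> A - measure \<nu> A = (INF \<pi>\<in>couplings \<mu> \<nu>. 1 - measure \<pi> R)"
proof -
  interpret M: prob_space \<mu> by (rule borel_probD[OF \<mu>])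
  interpret N: prob_space \<nu> by (rule borel_probD[OF \<nu>])
  note s[simp] = borel_probD(2)[OF \<mu>] borel_probD(2)[OF \<nu>]
  let ?\<gamma> = "INF \<pi>\<in>couplings \<mu> \<nu>. 1 - measure \<pi> R"
  obtain K where K: "\<And>n. closed (K n)" "\<And>n. K n \<subseteq> K (Suc n)" "R = (\<Union>n. K n)"
    using assms(3) unfolding fsigma_in_ascending closed_closedin[symmetric] by metis
  have inc: "incseq K" using K(2) by (rule incseq_SucI)
  have RB: "R \<in> sets borel" unfolding K(3) using K(1) by auto
  have le: "measure \<mu> B - measure \<nu> B \<le> ?\<gamma>" if "B \<in> upsets R" for B
  proof (rule cINF_greatest[OF couplings_nonempty[OF \<mu> \<nu>]])
    show "measure \<mu> B - measure \<nu> B \<le> 1 - measure \<pi> R" if "\<pi> \<in> couplings \<mu> \<nu>" for \<pi>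
      using \<open>B \<in> upsets R\<close> by (intro cut_le_coupling[OF that RB]) (auto simp: upsets_def)
  qed
  obtain D B where D: "D \<in> sets borel" "B \<in> sets borel" "R `` D \<subseteq> B" "?\<gamma> \<le> measure \<mu> D - measure \<nu> B"
    using fsigma_optimal_cut[OF \<mu> \<nu> K(1) inc K(3)] by blast
  obtain C where C: "\<And>n::nat. compact (C n)" "(\<Union>n. C n) \<subseteq> D" "measure \<mu> D \<le> measure \<mu> (\<Union>n. C n)"
    using inner_sigma_compact[OF \<mu> D(1)] by blast
  \<comment> \<open>Passing to a \<open>\<sigma>\<close>-compact set makes the image under \<open>R\<close> an \<open>F\<^sub>\<sigma>\<close> set rather than merely analytic.\<close>
  define U where "U = R `` (\<Union>n. C n)"
  have "U = (\<Union>i. \<Union>n. K i `` C n)" by (auto simp: U_def K(3))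
  moreover have "K i `` C n \<in> sets borel" for i n
    using closed_Image_compact[OF K(1) C(1)] by (rule borel_closed)
  ultimately have UB: "U \<in> sets borel" by auto
  have U: "U \<in> upsets R"
    unfolding upsets_def
  proof (intro CollectI conjI allI impI UB)
    show "y \<in> U" if "x \<in> U \<and> (x, y) \<in> R" for x y
      using that assms(2) unfolding U_def trans_def by blast
  qed
  have "measure \<mu> (\<Union>n. C n) \<le> measure \<mu> U"
    using UB assms(1) by (intro M.finite_measure_mono) (auto simp: U_def refl_on_def)
  moreover have "measure \<nu> U \<le> measure \<nu> B"
    using D(2,3) C(2) by (intro N.finite_measure_mono) (auto simp: U_def)
  ultimately have "?\<gamma> \<le> measure \<mu> U - measure \<nu> U" using C(3) D(4) by linarith
  then have "measure \<mu> U - measure \<nu> U = ?\<gamma>" using le[OF U] by linarith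
  then show ?thesis using U le by (intro bexI[of _ U]) auto
qed

section \<open>Failure of attainment\<close>

text \<open>
  Two copies of the line sit in \<open>\<real>\<^sup>\<nat>\<close> as the points whose first coordinate is the position and whose
  remaining coordinates are \<open>0\<close> or \<open>1\<close>.
\<close>
definition layer :: "real \<Rightarrow> real \<Rightarrow> nat \<Rightarrow> real" where
  "layer k t = (\<lambda>n. if n = 0 then t else k)"

text \<open>Coordinate 1 tells the layer, coordinate 0 the position. The strict inequality keeps the
  relation from being closed.\<close>

definition layer_order :: "((nat \<Rightarrow> real) \<times> (nat \<Rightarrow> real)) set" where
  "layer_order = Id \<union> {(f, g). f 1 = 0 \<and> g 1 = 1 \<and> f 0 < g 0}"

definition layer_measure :: "real \<Rightarrow> (nat \<Rightarrow> real) measure" where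
  "layer_measure k = distr (uniform_measure lborel {0..1}) borel (layer k)"

lemma refl_layer_order: "refl layer_order"
  by (auto simp: layer_order_def refl_on_def)

text \<open>No point is in both layers, so two steps other than the identity never compose.\<close>

lemma trans_layer_order: "trans layer_order"
  by (auto simp: layer_order_def trans_def)

text \<open>The strict inequality is the union over \<open>n\<close> of the closed conditions
  demanding a gap of at least 1/(n+1).\<close>

lemma fsigma_layer_order: "fsigma_in euclidean layer_order"
proof -
  define K where "K n = {p :: (nat \<Rightarrow> real) \<times> (nat \<Rightarrow> real). fst p 1 = 0 \<and> snd p 1 = 1 \<and> fst p 0 + inverse (real (Suc n)) \<le> snd p 0}" for n
  have [continuous_intros]: "continuous_on UNIV (\<lambda>p :: (nat \<Rightarrow> real) \<times> (nat \<Rightarrow> real). fst p i)"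
      "continuous_on UNIV (\<lambda>p :: (nat \<Rightarrow> real) \<times> (nat \<Rightarrow> real). snd p i)" for i
    by (rule continuous_on_product_then_coordinatewise; intro continuous_intros)+
  have "closed (K n)" for n
    unfolding K_def
    by (intro closed_Collect_conj closed_Collect_eq closed_Collect_le continuous_intros)
  moreover have "closed (Id :: ((nat \<Rightarrow> real) \<times> (nat \<Rightarrow> real)) set)"
    using closed_diagonal by (simp add: Id_def)
  moreover have "layer_order = Id \<union> (\<Union>n. K n)"
  proof -
    have "f 0 < g 0 \<longleftrightarrow> (\<exists>n. f 0 + inverse (real (Suc n)) \<le> g 0)" for f g :: "nat \<Rightarrow> real"
    proof
      assume "f 0 < g 0"
      then obtain n where "inverse (real (Suc n)) < g 0 - f 0" using reals_Archimedean[of "g 0 - f 0"] by auto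
      then show "\<exists>n. f 0 + inverse (real (Suc n)) \<le> g 0" by (intro exI[of _ n]) simp
    next
      assume "\<exists>n. f 0 + inverse (real (Suc n)) \<le> g 0"
      then obtain n where n: "f 0 + inverse (real (Suc n)) \<le> g 0" by blast
      have "0 < inverse (real (Suc n))" by simp
      then show "f 0 < g 0" using n by linarith
    qed
    then show ?thesis unfolding layer_order_def K_def by auto
  qed
  moreover have "fsigma_in euclidean (Id \<union> (\<Union>n. K n))"
    using calculation(1,2) by (intro fsigma_in_Un fsigma_in_Union) (auto intro: closed_imp_fsigma_in)
  ultimately show ?thesis by simp
qed

section \<open>Uniform laws on the two layers\<close>

lemma continuous_layer: "continuous_on UNIV (layer k)"
  unfolding layer_def
proof (rule continuous_on_coordinatewise_then_product)
  show "continuous_on UNIV (\<lambda>t. if i = 0 then t else k)" for i :: nat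
    by (cases "i = 0") simp_all
qed

lemma layer_measurable:
  assumes "sets M = sets borel"
  shows "layer k \<in> measurable M borel"
proof -
  have "layer k \<in> borel_measurable borel"
    by (rule borel_measurable_continuous_onI[OF continuous_layer])
  then show ?thesis using assms by (simp add: measurable_cong_sets[OF assms refl])
qed

lemma prob_space_unit: "prob_space (uniform_measure lborel {0..1::real})"
  by (rule prob_space_uniform_measure) auto

lemma sets_unit: "sets (uniform_measure lborel {0..1::real}) = sets borel"
  by simp

lemma borel_prob_layer_measure: "borel_prob (layer_measure k)"
  unfolding borel_prob_def layer_measure_def
  using prob_space.prob_space_distr[OF prob_space_unit layer_measurable[OF sets_unit]] by simp

lemma measure_layer_measure:
  assumes "A \<in> sets borel"
  shows "measure (layer_measure k) A = measure (uniform_measure lborel {0..1}) (layer k -` A)"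
  unfolding layer_measure_def
  by (subst measure_distr[OF layer_measurable[OF sets_unit] assms]) simp

text \<open>Combined with the duality, this bounds the infimum over couplings by 0.\<close>

lemma upset_layer_le:
  assumes A: "A \<in> upsets layer_order"
  shows "measure (layer_measure 0) A \<le> measure (layer_measure 1) A"
proof -
  interpret U: prob_space "uniform_measure lborel {0..1::real}" by (rule prob_space_unit)
  let ?P = "layer 0 -` A" and ?Q = "layer 1 -` A"
  have AB: "A \<in> sets borel" using A by (simp add: upsets_def)
  have PQ: "?P \<in> sets borel" "?Q \<in> sets borel"
    using measurable_sets[OF layer_measurable[of borel] AB] by auto
  have up: "y \<in> ?Q" if "x \<in> ?P" "x < y" for x y
  proof -
    have "(layer 0 x, layer 1 y) \<in> layer_order"
      using that by (simp add: layer_order_def layer_def)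
    then show ?thesis using A that by (auto simp: upsets_def)
  qed
  \<comment> \<open>An upset of the lower layer is caught by the upper layer except possibly for its least point.\<close>
  have uniq: "x = y" if "x \<in> ?P - ?Q" "y \<in> ?P - ?Q" for x y
    using up[of x y] up[of y x] that by (metis DiffE linorder_neqE)
  have "countable (?P - ?Q)"
  proof (cases "?P - ?Q = {}")
    case False
    then obtain z where z: "z \<in> ?P - ?Q" by auto
    have "?P - ?Q \<subseteq> {z}" using uniq[OF z] by auto
    then show ?thesis by (rule countable_subset) simp
  qed (simp only: countable_empty)
  then have "emeasure lborel ({0..1} \<inter> (?P - ?Q)) = 0"
    by (intro emeasure_lborel_countable) auto
  then have 0: "measure (uniform_measure lborel {0..1}) (?P - ?Q) = 0"
    using PQ by (simp add: measure_def)
  have "measure (uniform_measure lborel {0..1}) ?P \<le> measure (uniform_measure lborel {0..1}) (?Q \<union> (?P - ?Q))"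
    using PQ by (intro U.finite_measure_mono) auto
  also have "\<dots> \<le> measure (uniform_measure lborel {0..1}) ?Q + measure (uniform_measure lborel {0..1}) (?P - ?Q)"
    using PQ by (intro measure_Un_le) auto
  finally show ?thesis using 0 by (simp add: measure_layer_measure[OF AB])
qed

text \<open>Under full mass on the order the position would strictly increase almost surely,
  although both positions have the same law. A bounded strictly increasing function has the same
  integral under both, so the strict increase is impossible.\<close>

lemma layer_coupling_lt_1:
  assumes \<pi>: "\<pi> \<in> couplings (layer_measure 0) (layer_measure 1)"
  shows "measure \<pi> layer_order < 1"
proof (rule ccontr)
  assume "\<not> measure \<pi> layer_order < 1"
  interpret prob_space \<pi> by (rule couplingsD[OF \<pi>])
  note s = couplingsD(2,3)[OF \<pi>]
  have fst: "fst \<in> measurable \<pi> borel" and snd: "snd \<in> measurable \<pi> borel"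
    by (simp_all add: measurable_cong_sets[OF s(1) refl] flip: borel_prod)
  have ev: "(\<lambda>f :: nat \<Rightarrow> real. f i) \<in> borel_measurable borel" for i
    by (intro borel_measurable_continuous_onI) simp
  have "prob layer_order = 1"
    using \<open>\<not> _\<close> prob_le_1[of layer_order] by linarith
  then have ord: "AE p in \<pi>. p \<in> layer_order" by (rule AE_prob_1)
  have AE_layer: "AE f in layer_measure k. f 1 = k" for k
    unfolding layer_measure_def
    by (subst AE_distr_iff[OF layer_measurable[OF sets_unit]])
      (use ev[of 1] in \<open>auto simp: layer_def\<close>)
  have "AE f in distr \<pi> borel fst. f 1 = 0"
    unfolding couplingsD(4)[OF \<pi>] by (rule AE_layer)
  then have "AE p in \<pi>. fst p 1 = 0"
    using ev[of 1] by (subst (asm) AE_distr_iff[OF fst]) auto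
  moreover have "AE f in distr \<pi> borel snd. f 1 = 1"
    unfolding couplingsD(5)[OF \<pi>] by (rule AE_layer)
  then have "AE p in \<pi>. snd p 1 = 1"
    using ev[of 1] by (subst (asm) AE_distr_iff[OF snd]) auto
  \<comment> \<open>The second coordinates 0 and 1 rule out the identity part of the order.
    \<open>arctan\<close> supplies boundedness, hence integrability, while preserving strict
    inequalities.\<close>
  ultimately have less: "AE p in \<pi>. arctan (fst p 0) < arctan (snd p 0)"
    using ord by eventually_elim (auto simp: layer_order_def arctan_less_iff)
  have at: "(\<lambda>f :: nat \<Rightarrow> real. arctan (f 0)) \<in> borel_measurable borel"
    using ev[of 0] by (intro borel_measurable_continuous_onI continuous_intros) auto
  have mf: "(\<lambda>p. arctan (fst p 0)) \<in> borel_measurable \<pi>" and ms: "(\<lambda>p. arctan (snd p 0)) \<in> borel_measurable \<pi>"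
    using measurable_compose[OF fst at] measurable_compose[OF snd at] by auto
  have bd: "norm (arctan t) \<le> pi / 2" for t :: real
    using arctan_bounded[of t] unfolding real_norm_def by linarith
  have int: "integrable \<pi> (\<lambda>p. arctan (fst p 0))" "integrable \<pi> (\<lambda>p. arctan (snd p 0))"
    by (rule integrable_const_bound[OF AE_I2[OF bd] mf] integrable_const_bound[OF AE_I2[OF bd] ms])+
  have layer_int: "(\<integral>f. arctan (f 0) \<partial>layer_measure k) = (\<integral>t. arctan t \<partial>uniform_measure lborel {0..1})" for k
    unfolding layer_measure_def
    by (subst integral_distr[OF layer_measurable[OF sets_unit] at]) (simp add: layer_def)
  have "(\<integral>p. arctan (fst p 0) \<partial>\<pi>) = (\<integral>f. arctan (f 0) \<partial>layer_measure 0)"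
    using integral_distr[OF fst at] couplingsD(4)[OF \<pi>] by simp
  moreover have "(\<integral>p. arctan (snd p 0) \<partial>\<pi>) = (\<integral>f. arctan (f 0) \<partial>layer_measure 1)"
    using integral_distr[OF snd at] couplingsD(5)[OF \<pi>] by simp
  ultimately have "(\<integral>p. arctan (snd p 0) - arctan (fst p 0) \<partial>\<pi>) = 0"
    using int by (simp add: layer_int)
  moreover have "AE p in \<pi>. 0 \<le> arctan (snd p 0) - arctan (fst p 0)"
    using less by eventually_elim simp
  ultimately have "AE p in \<pi>. arctan (snd p 0) - arctan (fst p 0) = 0"
    using integral_nonneg_eq_0_iff_AE[of \<pi> "\<lambda>p. arctan (snd p 0) - arctan (fst p 0)"] int by simp
  with less have "AE p in \<pi>. False" by eventually_elim simp
  then show False by simp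
qed

theorem theorem1p1:
  fixes R :: "('a::polish_space \<times> 'a) set" and \<mu> \<nu> :: "'a measure"
  assumes "refl R" and "trans R" and "fsigma_in euclidean R"
    and "borel_prob \<mu>" and "borel_prob \<nu>"
  shows "(\<exists>A\<in>upsets R.
            (\<forall>B\<in>upsets R. measure \<mu> B - measure \<nu> B \<le> measure \<mu> A - measure \<nu> A) \<and>
            measure \<mu> A - measure \<nu> A = (INF \<pi>\<in>couplings \<mu> \<nu>. 1 - measure \<pi> R))
     \<and> (\<exists>(R' :: ((nat \<Rightarrow> real) \<times> (nat \<Rightarrow> real)) set) \<mu>' \<nu>'.
            refl R' \<and> trans R' \<and> fsigma_in euclidean R' \<and> borel_prob \<mu>' \<and> borel_prob \<nu>' \<and>
            \<not> (\<exists>\<pi>\<in>couplings \<mu>' \<nu>'. 1 - measure \<pi> R' = (INF \<pi>\<in>couplings \<mu>' \<nu>'. 1 - measure \<pi> R')))"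
proof (rule conjI[OF fsigma_strassen[OF assms]], intro exI conjI)
  show "refl layer_order" "trans layer_order" "fsigma_in euclidean layer_order"
    by (fact refl_layer_order trans_layer_order fsigma_layer_order)+
  show "borel_prob (layer_measure 0)" "borel_prob (layer_measure 1)"
    by (rule borel_prob_layer_measure)+
  let ?\<gamma> = "INF \<pi>\<in>couplings (layer_measure 0) (layer_measure 1). 1 - measure \<pi> layer_order"
  \<comment> \<open>The infimum equals the value of some upset, which is at most 0. A minimizer
    would therefore give the order mass at least 1.\<close>
  have "?\<gamma> \<le> 0"
    using fsigma_strassen[OF refl_layer_order trans_layer_order fsigma_layer_order
        borel_prob_layer_measure[of 0] borel_prob_layer_measure[of 1]] upset_layer_le by force
  then show "\<not> (\<exists>\<pi>\<in>couplings (layer_measure 0) (layer_measure 1). 1 - measure \<pi> layer_order = ?\<gamma>)"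
    using layer_coupling_lt_1 by fastforce
qed

end
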